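(* Let $(\epsilon_n)$ be a sequence of positive numbers and suppose that the posterior distribution $\widetilde\Pi_n(v\in\cdot\mid\widetilde Y_n)$ of $v$ in model (L) contracts under $v_0$ to $v_0=\mathbb{L}u_{f_0}$ at rate $\epsilon_n$ in $(V,\|\cdot\|)$. Let $f=e(v)$ hold for $v=\mathbb{L}u_f$, and suppose that there exist Borel sets $V_n\subseteq V$ and functions $\omega_n:[0,\infty)\to[0,\infty)$ such that (i) each $\omega_n$ is non-decreasing with $\omega_n(t)\to0$ as $t\downarrow0$; (ii) for every $v\in V_n$, $\|e(v)-e(v_0)\|_{L^2}\le\omega_n(\|v-v_0\|)$; (iii) $\widetilde\Pi_n(V_n\mid\widetilde Y_n)\to1$ in $P_{v_0}$-probability. Then for every sequence $M_n\to\infty$, $$\Pi_n\bigl(f:\|f-f_0\|_{L^2}>\omega_n(M_n\epsilon_n)\mid Y_n\bigr)\to0\quad\text{in }P_{f_0}\text{-probability}.$$ If in addition each $\omega_n$ is concave, then the posterior distribution of $f$ in model (N) attains the contraction rate $\omega_n(\epsilon_n)$ under $f_0$ relative to the $L^2$-norm.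
   Context: Setting. $\mathcal{O}\subset\mathbb{R}^d$ is a bounded domain, $V=L^2(\mathcal{O})$ with norm $\|\cdot\|$, $\mathbb{L}$ is a linear differential operator with (homogeneous boundary condition) inverse $\mathcal{K}=\mathbb{L}^{-1}$, a bounded linear operator on $V$. For each $f$ in a parameter set $\mathcal{F}\subset L^2(\mathcal{O})$, $u_f$ denotes the solution of a semilinear PDE $\mathbb{L}u_f-C(u_f;f)=h$ with fixed known boundary data, and $\tilde g$ is the unique function with $\mathbb{L}\tilde g=0$ having the same boundary data, so that $u_f=\mathcal{K}\mathbb{L}u_f+\tilde g$. There is a solution map $e$, defined on elements of $V$, with $f=e(\mathbb{L}u_f)$. The true parameter is $f_0$, and $v_0=\mathbb{L}u_{f_0}$ (so $f_0=e(v_0)$). Model (N): one observes $Y_n=u_f+n^{-1/2}\Xi$ with $\Xi$ Gaussian white noise. Model (L): one observes $\widetilde Y_n=\mathcal{K}v+n^{-1/2}\Xi$; for $v=\mathbb{L}u_f$ this corresponds to $\widetilde Y_n=Y_n-\tilde g$. $P_{f_0}$, $P_{v_0}$ denote the laws of the data under $f_0$, $v_0$. A prior $\widetilde\Pi_n$ is placed on $v$; $\widetilde\Pi_n(\cdot\mid\widetilde Y_n)$ is the posterior in model (L). The prior $\Pi_n$ on $f$ is the one induced via $f=e(v)$, i.e. under $\Pi_n$ the distribution of $\mathbb{L}u_f$ equals $\widetilde\Pi_n$; $\Pi_n(\cdot\mid Y_n)$ is the resulting posterior in model (N). Contraction rate: a sequence $(\epsilon_n)$ of positive numbers is a posterior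 contraction rate at the truth $\theta_0$ with respect to a semi-metric $\rho$ if for every $M_n\to\infty$ the posterior probability of $\{\theta:\rho(\theta,\theta_0)\ge M_n\epsilon_n\}$ tends to $0$ in probability under the law of the data generated by $\theta_0$.
   Formalization: The second claim additionally assumes ω_n(ε_n) > 0 for every n ≥ 1, as a contraction rate must be a sequence of positive numbers; for concave ω_n this excludes only ω_n identically zero, where the claim fails. *)

theory Defs
  imports "HOL-Probability.Probability"
begin

section \<open>The Hilbert space of square integrable functions\<close>

definition sq_integrable :: "('a::euclidean_space \<Rightarrow> real) \<Rightarrow> bool" where
  "sq_integrable f \<longleftrightarrow> f \<in> borel_measurable lborel \<and> integrable lborel (\<lambda>x. (f x)\<^sup>2)"

lemma sq_integrable_measurable: "sq_integrable f \<Longrightarrow> f \<in> borel_measurable borel"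
  by (simp add: sq_integrable_def)

lemma sq_integrable_zero: "sq_integrable (\<lambda>x. 0)"
  by (simp add: sq_integrable_def)

lemma sq_integrable_mult:
  assumes "sq_integrable f" "sq_integrable g"
  shows "integrable lborel (\<lambda>x. f x * g x)"
proof (rule Bochner_Integration.integrable_bound)
  show "integrable lborel (\<lambda>x. (f x)\<^sup>2 + (g x)\<^sup>2)"
    using assms by (simp add: sq_integrable_def)
  show "(\<lambda>x. f x * g x) \<in> borel_measurable lborel"
    using assms[THEN sq_integrable_measurable] by simp
  have "\<bar>f x * g x\<bar> \<le> (f x)\<^sup>2 + (g x)\<^sup>2" for x
  proof -
    have "2 * \<bar>f x\<bar> * \<bar>g x\<bar> \<le> (f x)\<^sup>2 + (g x)\<^sup>2"
      using sum_squares_bound[of "\<bar>f x\<bar>" "\<bar>g x\<bar>"] by simp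
    moreover have "0 \<le> \<bar>f x\<bar> * \<bar>g x\<bar>"
      by simp
    ultimately show ?thesis
      unfolding abs_mult by linarith
  qed
  then show "AE x in lborel. norm (f x * g x) \<le> norm ((f x)\<^sup>2 + (g x)\<^sup>2)"
    by (simp add: real_norm_def)
qed

lemma sq_integrable_add:
  assumes "sq_integrable f" "sq_integrable g"
  shows "sq_integrable (\<lambda>x. f x + g x)"
proof -
  have "integrable lborel (\<lambda>x. (f x)\<^sup>2 + 2 * (f x * g x) + (g x)\<^sup>2)"
    using assms sq_integrable_mult[OF assms] by (simp add: sq_integrable_def)
  then have "integrable lborel (\<lambda>x. (f x + g x)\<^sup>2)"
    by (simp add: power2_sum ac_simps)
  moreover have "(\<lambda>x. f x + g x) \<in> borel_measurable lborel"
    using assms[THEN sq_integrable_measurable] by simp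
  ultimately show ?thesis
    by (simp add: sq_integrable_def)
qed

lemma sq_integrable_scale:
  assumes "sq_integrable f"
  shows "sq_integrable (\<lambda>x. c * f x)"
proof -
  have "(\<lambda>x. c * f x) \<in> borel_measurable lborel"
    using assms[THEN sq_integrable_measurable] by simp
  then show ?thesis
    using assms by (simp add: sq_integrable_def power_mult_distrib)
qed

definition l2_rel :: "('a::euclidean_space \<Rightarrow> real) \<Rightarrow> ('a \<Rightarrow> real) \<Rightarrow> bool" where
  "l2_rel f g \<longleftrightarrow> sq_integrable f \<and> sq_integrable g \<and> (AE x in lborel. f x = g x)"

text \<open>\<open>'a l2\<close> is the space L2 over the whole of \<open>'a\<close>; classes of Borel functions modulo null sets are enough,
  since every Lebesgue measurable function agrees almost everywhere with a Borel function.\<close>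

quotient_type (overloaded) 'a l2 = "'a::euclidean_space \<Rightarrow> real" / partial: l2_rel
proof (rule part_equivpI)
  show "\<exists>f::'a \<Rightarrow> real. l2_rel f f"
    using sq_integrable_zero by (auto simp: l2_rel_def)
  show "symp (l2_rel :: ('a \<Rightarrow> real) \<Rightarrow> _)"
    by (auto simp: symp_def l2_rel_def elim: AE_mp)
  show "transp (l2_rel :: ('a \<Rightarrow> real) \<Rightarrow> _)"
    by (auto simp: transp_def l2_rel_def elim: AE_mp)
qed

instantiation l2 :: (euclidean_space) real_inner
begin

lift_definition zero_l2 :: "'a l2" is "\<lambda>x. 0"
  by (simp add: l2_rel_def sq_integrable_zero)

lift_definition plus_l2 :: "'a l2 \<Rightarrow> 'a l2 \<Rightarrow> 'a l2" is "\<lambda>f g x. f x + g x"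
  by (auto simp: l2_rel_def sq_integrable_add elim!: AE_mp)

lift_definition scaleR_l2 :: "real \<Rightarrow> 'a l2 \<Rightarrow> 'a l2" is "\<lambda>c f x. c * f x"
  by (auto simp: l2_rel_def sq_integrable_scale elim!: AE_mp)

lift_definition uminus_l2 :: "'a l2 \<Rightarrow> 'a l2" is "\<lambda>f x. - f x"
  using sq_integrable_scale[where c = "-1"] by (auto simp: l2_rel_def elim!: AE_mp)

definition minus_l2 :: "'a l2 \<Rightarrow> 'a l2 \<Rightarrow> 'a l2" where
  "minus_l2 f g = f + - g"

lift_definition inner_l2 :: "'a l2 \<Rightarrow> 'a l2 \<Rightarrow> real" is "\<lambda>f g. \<integral>x. f x * g x \<partial>lborel"
proof -
  fix f f' g g' :: "'a \<Rightarrow> real"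
  assume "l2_rel f f'" "l2_rel g g'"
  then show "(\<integral>x. f x * g x \<partial>lborel) = (\<integral>x. f' x * g' x \<partial>lborel)"
    by (intro integral_cong_AE) (auto simp: l2_rel_def sq_integrable_def elim!: AE_mp)
qed

definition norm_l2 :: "'a l2 \<Rightarrow> real" where
  "norm_l2 f = sqrt (inner f f)"

definition sgn_l2 :: "'a l2 \<Rightarrow> 'a l2" where
  "sgn_l2 f = inverse (norm f) *\<^sub>R f"

definition dist_l2 :: "'a l2 \<Rightarrow> 'a l2 \<Rightarrow> real" where
  "dist_l2 f g = norm (f - g)"

definition uniformity_l2 :: "('a l2 \<times> 'a l2) filter" where
  "uniformity_l2 = (INF e\<in>{0<..}. principal {(f, g). dist f g < e})"

definition open_l2 :: "'a l2 set \<Rightarrow> bool" where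
  "open_l2 A \<longleftrightarrow> (\<forall>f\<in>A. eventually (\<lambda>(f', g). f' = f \<longrightarrow> g \<in> A) uniformity)"

instance
proof
  fix f g h :: "'a l2" and a b :: real
  show "f + g + h = f + (g + h)"
    by transfer (auto simp: l2_rel_def sq_integrable_add add.assoc)
  show "f + g = g + f"
    by transfer (auto simp: l2_rel_def sq_integrable_add add.commute)
  show "0 + f = f"
    by transfer (auto simp: l2_rel_def)
  show "- f + f = 0"
    by transfer (auto simp: l2_rel_def sq_integrable_zero)
  show "f - g = f + - g"
    by (fact minus_l2_def)
  show "a *\<^sub>R (f + g) = a *\<^sub>R f + a *\<^sub>R g"
    by transfer (auto simp: l2_rel_def sq_integrable_add sq_integrable_scale distrib_left)
  show "(a + b) *\<^sub>R f = a *\<^sub>R f + b *\<^sub>R f"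
    by transfer (auto simp: l2_rel_def sq_integrable_add sq_integrable_scale distrib_right)
  show "a *\<^sub>R b *\<^sub>R f = (a * b) *\<^sub>R f"
    by transfer (auto simp: l2_rel_def sq_integrable_scale mult.assoc)
  show "1 *\<^sub>R f = f"
    by transfer (auto simp: l2_rel_def)
  show "sgn f = inverse (norm f) *\<^sub>R f"
    by (fact sgn_l2_def)
  show "dist f g = norm (f - g)"
    by (fact dist_l2_def)
  show "(uniformity :: ('a l2 \<times> 'a l2) filter) = (INF e\<in>{0<..}. principal {(f, g). dist f g < e})"
    by (fact uniformity_l2_def)
  show "open A \<longleftrightarrow> (\<forall>f\<in>A. eventually (\<lambda>(f', g). f' = f \<longrightarrow> g \<in> A) uniformity)" for A :: "'a l2 set"
    by (fact open_l2_def)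
  show "inner f g = inner g f"
    by transfer (simp add: mult.commute)
  show "inner (f + g) h = inner f h + inner g h"
    by transfer (simp add: l2_rel_def sq_integrable_mult distrib_right)
  show "inner (a *\<^sub>R f) g = a * inner f g"
    by transfer (simp add: l2_rel_def mult.assoc)
  show "0 \<le> inner f f"
    by transfer simp
  show "inner f f = 0 \<longleftrightarrow> f = 0"
  proof transfer
    fix f :: "'a \<Rightarrow> real"
    assume "l2_rel f f"
    then have f: "sq_integrable f"
      by (simp add: l2_rel_def)
    have "(\<integral>x. f x * f x \<partial>lborel) = 0 \<longleftrightarrow> (AE x in lborel. f x * f x = 0)"
      by (intro integral_nonneg_eq_0_iff_AE sq_integrable_mult f) simp
    then show "(\<integral>x. f x * f x \<partial>lborel) = 0 \<longleftrightarrow> l2_rel f (\<lambda>x. 0)"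
      using f by (simp add: l2_rel_def sq_integrable_zero)
  qed
  show "norm f = sqrt (inner f f)"
    by (fact norm_l2_def)
qed

end

text \<open>The space L2 over a set is the closed subspace of classes that vanish almost everywhere outside it;
  \<open>rep_l2 f\<close> is some representative of the class \<open>f\<close>.\<close>

definition L2 :: "'a::euclidean_space set \<Rightarrow> 'a l2 set" where
  "L2 \<Omega> = {f. AE x in lborel. x \<notin> \<Omega> \<longrightarrow> rep_l2 f x = 0}"

abbreviation borel_on :: "'b::topological_space set \<Rightarrow> 'b measure" where
  "borel_on A \<equiv> restrict_space borel A"


section \<open>Linear differential operators\<close>

definition partial_deriv :: "'a::euclidean_space \<Rightarrow> ('a \<Rightarrow> real) \<Rightarrow> 'a \<Rightarrow> real" where
  "partial_deriv b f x = frechet_derivative f (at x) b"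

text \<open>A multi-index is a list of basis vectors.\<close>

definition partial_derivs :: "'a::euclidean_space list \<Rightarrow> ('a \<Rightarrow> real) \<Rightarrow> 'a \<Rightarrow> real" where
  "partial_derivs \<alpha> f = foldr partial_deriv \<alpha> f"

definition test_functions :: "'a::euclidean_space set \<Rightarrow> ('a \<Rightarrow> real) set" where
  "test_functions \<Omega> =
    {\<phi>. (\<forall>\<alpha>. set \<alpha> \<subseteq> Basis \<longrightarrow> (\<forall>x. partial_derivs \<alpha> \<phi> differentiable (at x))) \<and>
        (\<exists>C. compact C \<and> C \<subseteq> \<Omega> \<and> (\<forall>x. x \<notin> C \<longrightarrow> \<phi> x = 0))}"

definition locally_integrable_on :: "('a::euclidean_space \<Rightarrow> real) \<Rightarrow> 'a set \<Rightarrow> bool" where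
  "locally_integrable_on f \<Omega> \<longleftrightarrow> (\<forall>C. compact C \<and> C \<subseteq> \<Omega> \<longrightarrow> set_integrable lborel C f)"

definition has_weak_deriv ::
  "'a::euclidean_space set \<Rightarrow> 'a list \<Rightarrow> ('a \<Rightarrow> real) \<Rightarrow> ('a \<Rightarrow> real) \<Rightarrow> bool" where
  "has_weak_deriv \<Omega> \<alpha> f w \<longleftrightarrow>
    locally_integrable_on f \<Omega> \<and> locally_integrable_on w \<Omega> \<and>
    (\<forall>\<phi>\<in>test_functions \<Omega>.
      (LINT x:\<Omega>|lborel. f x * partial_derivs \<alpha> \<phi> x) =
      (-1) ^ length \<alpha> * (LINT x:\<Omega>|lborel. w x * \<phi> x))"

definition linear_on :: "'b::real_vector set \<Rightarrow> ('b \<Rightarrow> 'c::real_vector) \<Rightarrow> bool" where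
  "linear_on S T \<longleftrightarrow>
    (\<forall>x\<in>S. \<forall>y\<in>S. T (x + y) = T x + T y) \<and> (\<forall>c. \<forall>x\<in>S. T (c *\<^sub>R x) = c *\<^sub>R T x)"

lemma linear_on_diff:
  assumes "linear_on S T" "subspace S" "x \<in> S" "y \<in> S"
  shows "T (x - y) = T x - T y"
proof -
  have "(-1) *\<^sub>R y \<in> S"
    using assms by (intro subspace_scale)
  then have "T (x + (-1) *\<^sub>R y) = T x + (-1) *\<^sub>R T y"
    using assms unfolding linear_on_def by metis
  then show ?thesis
    by simp
qed

definition bounded_linear_on ::
  "'b::real_normed_vector set \<Rightarrow> ('b \<Rightarrow> 'c::real_normed_vector) \<Rightarrow> bool" where
  "bounded_linear_on S T \<longleftrightarrow> linear_on S T \<and> (\<exists>c. \<forall>x\<in>S. norm (T x) \<le> c * norm x)"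

text \<open>An operator with domain \<open>D\<close> in \<open>L2 \<Omega>\<close> that acts, in the sense of distributions, as the finite sum
  over \<open>(\<alpha>, \<beta>)\<close> of \<open>\<partial>\<^sup>\<beta> (a\<^sub>\<alpha>\<^sub>\<beta> \<partial>\<^sup>\<alpha> u)\<close> with weak derivatives \<open>\<partial>\<^sup>\<alpha> u = w \<alpha>\<close>. The inner and
  outer derivatives allow nondivergence form (\<open>\<beta> = []\<close>), divergence form with nonsmooth
  coefficients, and operators whose single terms are only distributions (\<open>\<alpha> = []\<close>).\<close>

definition linear_differential_operator ::
  "'a::euclidean_space set \<Rightarrow> 'a l2 set \<Rightarrow> ('a l2 \<Rightarrow> 'a l2) \<Rightarrow> bool" where
  "linear_differential_operator \<Omega> D L \<longleftrightarrow>
    subspace D \<and> D \<subseteq> L2 \<Omega> \<and> L ` D \<subseteq> L2 \<Omega> \<and> linear_on D L \<and>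
    (\<exists>I a. finite I \<and> (\<forall>(\<alpha>, \<beta>)\<in>I. set \<alpha> \<subseteq> Basis \<and> set \<beta> \<subseteq> Basis) \<and>
      (\<forall>u\<in>D. \<exists>w.
        (\<forall>(\<alpha>, \<beta>)\<in>I. has_weak_deriv \<Omega> \<alpha> (rep_l2 u) (w \<alpha>) \<and>
                    locally_integrable_on (\<lambda>x. a (\<alpha>, \<beta>) x * w \<alpha> x) \<Omega>) \<and>
        (\<forall>\<phi>\<in>test_functions \<Omega>.
          (LINT x:\<Omega>|lborel. rep_l2 (L u) x * \<phi> x) =
          (\<Sum>(\<alpha>, \<beta>)\<in>I. (-1) ^ length \<beta> *
            (LINT x:\<Omega>|lborel. a (\<alpha>, \<beta>) x * w \<alpha> x * partial_derivs \<beta> \<phi> x)))))"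


section \<open>The semilinear boundary value problem\<close>

text \<open>\<open>B\<close> takes a function in the domain of \<open>L\<close> to its boundary data, \<open>g\<close> is the prescribed data,
  \<open>K\<close> is the inverse of \<open>L\<close> under homogeneous boundary conditions, and \<open>u f\<close> is the solution for
  the parameter \<open>f\<close>. Functions in \<open>D\<close> with compact support in the domain have zero boundary data.\<close>

locale semilinear_bvp =
  fixes \<Omega> :: "'a::euclidean_space set"
    and D :: "'a l2 set"
    and L :: "'a l2 \<Rightarrow> 'a l2"
    and B :: "'a l2 \<Rightarrow> 'b::real_vector"
    and K :: "'a l2 \<Rightarrow> 'a l2"
    and C :: "'a l2 \<Rightarrow> 'a l2 \<Rightarrow> 'a l2"
    and h :: "'a l2"
    and g :: 'b
    and gt :: "'a l2"
    and F :: "'a l2 set"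
    and u :: "'a l2 \<Rightarrow> 'a l2"
    and e :: "'a l2 \<Rightarrow> 'a l2"
  assumes domain: "open \<Omega>" "connected \<Omega>" "\<Omega> \<noteq> {}" "bounded \<Omega>"
    and diff_op: "linear_differential_operator \<Omega> D L"
    and boundary_linear: "linear_on D B"
    and boundary_local: "\<And>w A. w \<in> D \<Longrightarrow> compact A \<Longrightarrow> A \<subseteq> \<Omega> \<Longrightarrow>
        AE x in lborel. x \<notin> A \<longrightarrow> rep_l2 w x = 0 \<Longrightarrow> B w = 0"
    and K_bounded_linear: "K \<in> L2 \<Omega> \<rightarrow> L2 \<Omega>" "bounded_linear_on (L2 \<Omega>) K"
    and K_right_inverse: "\<And>v. v \<in> L2 \<Omega> \<Longrightarrow> K v \<in> D \<and> B (K v) = 0 \<and> L (K v) = v"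
    and K_left_inverse: "\<And>w. w \<in> D \<Longrightarrow> B w = 0 \<Longrightarrow> K (L w) = w"
    and source: "h \<in> L2 \<Omega>"
    and parameters: "F \<subseteq> L2 \<Omega>"
    and solution: "\<And>f. f \<in> F \<Longrightarrow> u f \<in> D \<and> B (u f) = g \<and> L (u f) - C (u f) f = h"
    and solution_unique: "\<And>f w. f \<in> F \<Longrightarrow> w \<in> D \<Longrightarrow> B w = g \<Longrightarrow> L w - C w f = h \<Longrightarrow> w = u f"
    and extension: "gt \<in> D" "L gt = 0" "B gt = g"
    and solution_map: "e \<in> L2 \<Omega> \<rightarrow> L2 \<Omega>" "\<And>f. f \<in> F \<Longrightarrow> f = e (L (u f))"
begin

lemma solution_eq:
  assumes "f \<in> F"
  shows "u f = K (L (u f)) + gt"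
proof -
  have D: "subspace D" and lin: "linear_on D L"
    using diff_op by (auto simp: linear_differential_operator_def)
  have u: "u f \<in> D" "B (u f) = g"
    using solution[OF assms] by auto
  have "L (u f - gt) = L (u f)" "B (u f - gt) = 0"
    using linear_on_diff[OF lin D u(1) extension(1)]
      linear_on_diff[OF boundary_linear D u(1) extension(1)] u extension by auto
  then show ?thesis
    using K_left_inverse[of "u f - gt"] subspace_diff[OF D u(1) extension(1)] by simp
qed

lemma extension_unique:
  assumes "w \<in> D" "L w = 0" "B w = g"
  shows "w = gt"
proof -
  have D: "subspace D" and lin: "linear_on D L"
    using diff_op by (auto simp: linear_differential_operator_def)
  have "L (w - gt) = 0" "B (w - gt) = 0"
    using linear_on_diff[OF lin D assms(1) extension(1)]
      linear_on_diff[OF boundary_linear D assms(1) extension(1)] assms extension by auto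
  then have "K 0 = w - gt"
    using K_left_inverse[of "w - gt"] subspace_diff[OF D assms(1) extension(1)] by simp
  moreover have "K 0 = 0"
    using K_left_inverse[of "gt - gt"] linear_on_diff[OF lin D extension(1,1)]
      linear_on_diff[OF boundary_linear D extension(1,1)] subspace_0[OF D] by simp
  ultimately show ?thesis
    by simp
qed

text \<open>If the image of a prior \<open>\<mu>\<close> on \<open>F\<close> under \<open>f \<mapsto> L (u f)\<close> is \<open>\<nu>\<close>, then \<open>\<mu>\<close> is the image of
  \<open>\<nu>\<close> under the solution map.\<close>

lemma induced_prior:
  assumes "sets \<mu> = sets (borel_on F)" "(\<lambda>f. L (u f)) \<in> \<mu> \<rightarrow>\<^sub>M borel_on (L2 \<Omega>)"
    and "distr \<mu> (borel_on (L2 \<Omega>)) (\<lambda>f. L (u f)) = \<nu>"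
    and "A \<in> sets \<mu>" "{v \<in> L2 \<Omega>. e v \<in> A} \<in> sets (borel_on (L2 \<Omega>))"
  shows "emeasure \<mu> A = emeasure \<nu> {v \<in> L2 \<Omega>. e v \<in> A}"
proof -
  have sp: "space \<mu> = F"
    using sets_eq_imp_space_eq[OF assms(1)] by (simp add: space_restrict_space)
  have "L (u f) \<in> L2 \<Omega>" if "f \<in> F" for f
    using solution[OF that] diff_op by (auto simp: linear_differential_operator_def)
  then have "(\<lambda>f. L (u f)) -` {v \<in> L2 \<Omega>. e v \<in> A} \<inter> space \<mu> = A"
    using solution_map(2) sets.sets_into_space[OF assms(4)] by (force simp: sp)
  then show ?thesis
    using emeasure_distr[OF assms(2,5)] assms(3) by simp
qed

end


section \<open>Gaussian white noise and posterior distributions\<close>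

definition centered_normal :: "real \<Rightarrow> real measure" where
  "centered_normal \<sigma> = (if \<sigma> = 0 then return borel 0 else density lborel (normal_density 0 \<sigma>))"

text \<open>The isonormal process indexed by \<open>V\<close>: a centered Gaussian process (all finite linear
  combinations are normal) whose covariance function is the inner product of \<open>V\<close>.\<close>

definition white_noise ::
  "'w measure \<Rightarrow> 'v::real_inner set \<Rightarrow> ('v \<Rightarrow> 'w \<Rightarrow> real) \<Rightarrow> bool" where
  "white_noise M V \<Xi> \<longleftrightarrow>
    prob_space M \<and> (\<forall>\<phi>\<in>V. \<Xi> \<phi> \<in> borel_measurable M) \<and>
    (\<forall>J c. finite J \<and> J \<subseteq> V \<longrightarrow>
      distr M borel (\<lambda>\<omega>. \<Sum>\<phi>\<in>J. c \<phi> * \<Xi> \<phi> \<omega>) =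
      centered_normal (sqrt (\<Sum>\<phi>\<in>J. \<Sum>\<psi>\<in>J. c \<phi> * c \<psi> * inner \<phi> \<psi>)))"

abbreviation data_space :: "'v set \<Rightarrow> ('v \<Rightarrow> real) measure" where
  "data_space V \<equiv> (\<Pi>\<^sub>M \<phi>\<in>V. borel)"

text \<open>The law of the observation \<open>\<theta> + \<Xi> / \<surd>n\<close>, as a process indexed by \<open>V\<close>.\<close>

definition data_law ::
  "'w measure \<Rightarrow> ('v \<Rightarrow> 'w \<Rightarrow> real) \<Rightarrow> 'v::real_inner set \<Rightarrow> nat \<Rightarrow> 'v \<Rightarrow> ('v \<Rightarrow> real) measure"
  where
  "data_law M \<Xi> V n \<theta> =
    distr M (data_space V) (\<lambda>\<omega>. \<lambda>\<phi>\<in>V. inner \<theta> \<phi> + real n powr (-1/2) * \<Xi> \<phi> \<omega>)"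

text \<open>\<open>\<kappa>\<close> is a version of the conditional distribution of the parameter given the data, if the
  parameter has law \<open>\<pi>\<close> and the data have law \<open>P \<theta>\<close> given the parameter \<open>\<theta>\<close>: both sides are the
  joint probability that the data lie in \<open>A\<close> and the parameter lies in \<open>E\<close>.\<close>

definition is_posterior ::
  "'y measure \<Rightarrow> 't measure \<Rightarrow> ('t \<Rightarrow> 'y measure) \<Rightarrow> ('y \<Rightarrow> 't measure) \<Rightarrow> bool" where
  "is_posterior S \<pi> P \<kappa> \<longleftrightarrow>
    \<kappa> \<in> S \<rightarrow>\<^sub>M prob_algebra \<pi> \<and>
    (\<forall>A\<in>sets S. \<forall>E\<in>sets \<pi>.
      (\<integral>\<^sup>+\<theta>\<in>E. emeasure (P \<theta>) A \<partial>\<pi>) =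
      (\<integral>\<^sup>+\<theta>. (\<integral>\<^sup>+y\<in>A. emeasure (\<kappa> y) E \<partial>P \<theta>) \<partial>\<pi>))"

definition tends_in_prob ::
  "(nat \<Rightarrow> 'y measure) \<Rightarrow> (nat \<Rightarrow> 'y \<Rightarrow> real) \<Rightarrow> real \<Rightarrow> bool" where
  "tends_in_prob P X c \<longleftrightarrow>
    (\<forall>\<delta>>0. (\<lambda>n. measure (P n) {y \<in> space (P n). \<bar>X n y - c\<bar> > \<delta>}) \<longlonglongrightarrow> 0)"

text \<open>\<open>P n\<close> is the law of the data at stage \<open>n\<close> under the truth \<open>\<theta>0\<close>; stages start at \<open>n = 1\<close>.\<close>

definition contraction_rate ::
  "(nat \<Rightarrow> 'y measure) \<Rightarrow> (nat \<Rightarrow> 'y \<Rightarrow> 't measure) \<Rightarrow> 't set \<Rightarrow> ('t \<Rightarrow> 't \<Rightarrow> real) \<Rightarrow> 't \<Rightarrow>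
    (nat \<Rightarrow> real) \<Rightarrow> bool" where
  "contraction_rate P \<kappa> \<Theta> \<rho> \<theta>0 \<epsilon> \<longleftrightarrow>
    (\<forall>n\<ge>1. \<epsilon> n > 0) \<and>
    (\<forall>m. filterlim m at_top sequentially \<longrightarrow>
      tends_in_prob P (\<lambda>n y. measure (\<kappa> n y) {\<theta>\<in>\<Theta>. \<rho> \<theta> \<theta>0 \<ge> m n * \<epsilon> n}) 0)"

end

theory Submission
  imports Defs
begin

text \<open>
  Since \<open>f = e (L (u f))\<close>, the stability estimate turns a parameter \<open>f\<close> that is far from \<open>f0\<close> into a
  bad \<open>v = L (u f)\<close>: if \<open>norm (f - f0) > \<omega> n r\<close>, then \<open>v\<close> lies outside \<open>Vn n\<close> or
  \<open>norm (v - v0) \<ge> r\<close>, by monotonicity of \<open>\<omega> n\<close>. In model (L) the posterior gives little mass to both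
  events. So everything rests on the identity

    posterior mass of \<open>{f. L (u f) \<in> E}\<close> in model (N) = posterior mass of \<open>E\<close> in model (L),

  in which the data of model (N) are those of model (L) shifted by \<open>gt\<close>, because
  \<open>u f = K (L (u f)) + gt\<close>. The image of the posterior of model (N) under this shift of the data and
  under \<open>f \<mapsto> L (u f)\<close> satisfies the defining equation of the posterior of model (L)
  (\<open>posterior_pushforward\<close>).

  A posterior is a conditional distribution, and so the identity holds only up to null sets of the
  marginal law of the data (\<open>posterior_AE_unique\<close>), whereas the claim is about the law under the truth,
  which is one point of the parameter space and may have prior mass zero. The gap is closed by the
  Cameron-Martin theorem: all the laws of the data in model (L) have the same null sets, so a null set
  of the marginal law, being null for almost every parameter, is null for the truth
  (\<open>posterior_AE_unique_dominated\<close>).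

  The form of Cameron-Martin used here concerns null sets only
  (\<open>data_law_absolutely_continuous\<close>), and its proof computes no density. Along a unit vector \<open>h\<close>, the
  value \<open>\<Xi> h\<close> can be replaced by a fresh standard normal variable \<open>z\<close> without changing the law of the
  whole process (\<open>white_noise_refresh_direction\<close>). A shift of the signal along \<open>h\<close> then becomes a
  translation of \<open>z\<close>, and the normal law and its translates have the same null sets on the line. That
  the law of the process does not change is read off from the characteristic functions of linear
  combinations, which determine the law of any real process (\<open>process_law_eqI\<close>).

  For a concave modulus, \<open>\<omega> n (t * x) \<le> t * \<omega> n x\<close> for \<open>t \<ge> 1\<close> moves the factor \<open>M\<^sub>n\<close> out of \<open>\<omega> n\<close>. Using
  the first part with \<open>M\<^sub>n / 2\<close> makes room for the passage from \<open>>\<close> to \<open>\<ge>\<close>.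
\<close>

section \<open>Characteristic functions determine the law of a process\<close>

text \<open>The uniqueness theorem of Levy is about probability measures on the line, and is extended here to a
  signed weight \<open>U\<close> by passing to the density \<open>2 + U\<close>. This is at least 1, so the normalising constant
  \<open>c\<close> cannot vanish, as it might with \<open>1 + U\<close>.\<close>

lemma tilted_law:
  fixes M :: "'w measure" and X U :: "'w \<Rightarrow> real"
  assumes "prob_space M" and X[measurable]: "X \<in> borel_measurable M"
    and U[measurable]: "U \<in> borel_measurable M" and bound: "\<And>w. \<bar>U w\<bar> \<le> 1"
  defines "c \<equiv> 2 + (\<integral>w. U w \<partial>M)"
  defines "T \<equiv> distr (density M (\<lambda>w. ennreal ((2 + U w) / c))) borel X"
  shows "real_distribution T"
    and "char T s = (2 * (CLINT w|M. iexp (s * X w)) + (CLINT w|M. iexp (s * X w) * of_real (U w))) / of_real c"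
    and "A \<in> sets borel \<Longrightarrow>
      measure T A = (2 * (\<integral>w. indicator A (X w) \<partial>M) + (\<integral>w. indicator A (X w) * U w \<partial>M)) / c"
    and "0 < c"
proof -
  interpret prob_space M by fact
  have iU: "integrable M U"
    using bound by (intro integrable_const_bound[where B=1]) auto
  have pos: "0 < 2 + U w" for w
    using bound[of w] by linarith
  have "- 1 \<le> (\<integral>w. U w \<partial>M)"
    using integral_ge_const[OF iU, of "-1"] bound by (auto simp: abs_le_iff minus_le_iff)
  then show c: "0 < c"
    by (simp add: c_def)
  have wpos: "0 \<le> (2 + U w) / c" for w
    using pos[of w] c by simp
  have "(\<integral>\<^sup>+w. ennreal ((2 + U w) / c) \<partial>M) = ennreal (\<integral>w. (2 + U w) / c \<partial>M)"
    using iU wpos by (intro nn_integral_eq_integral) auto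
  also have "(\<integral>w. (2 + U w) / c \<partial>M) = 1"
    using iU c by (simp add: c_def prob_space)
  finally have "prob_space (density M (\<lambda>w. ennreal ((2 + U w) / c)))"
    by (intro prob_spaceI) (simp add: emeasure_density)
  then have "prob_space T"
    unfolding T_def by (rule prob_space.prob_space_distr) simp
  then show T: "real_distribution T"
    by (simp add: real_distribution_def real_distribution_axioms_def T_def)
  interpret T: real_distribution T by fact
  have i1: "integrable M (\<lambda>w. iexp (s * X w))"
    by (intro integrable_const_bound[where B=1]) auto
  have i2: "integrable M (\<lambda>w. iexp (s * X w) * of_real (U w))"
    using bound by (intro integrable_const_bound[where B=1]) (auto simp: norm_mult)
  have "char T s = (CLINT w|M. ((2 + U w) / c) *\<^sub>R iexp (s * X w))"
    unfolding char_def T_def using wpos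
    by (subst integral_distr; simp?) (subst integral_density; simp)
  also have "\<dots> = (CLINT w|M. (2 * iexp (s * X w) + iexp (s * X w) * of_real (U w)) / of_real c)"
    by (intro Bochner_Integration.integral_cong) (auto simp: scaleR_conv_of_real field_simps)
  also have "\<dots> = (2 * (CLINT w|M. iexp (s * X w)) + (CLINT w|M. iexp (s * X w) * of_real (U w))) / of_real c"
    using i1 i2 by simp
  finally show "char T s = (2 * (CLINT w|M. iexp (s * X w)) + (CLINT w|M. iexp (s * X w) * of_real (U w))) / of_real c" .
  assume A[measurable]: "A \<in> sets borel"
  have j1: "integrable M (\<lambda>w. indicator A (X w) :: real)"
    by (intro integrable_const_bound[where B=1]) (auto split: split_indicator)
  have j2: "integrable M (\<lambda>w. indicator A (X w) * U w)"
    using bound by (intro integrable_const_bound[where B=1]) (auto split: split_indicator)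
  have "measure T A = (\<integral>x. indicator A x \<partial>T)"
    by simp
  also have "\<dots> = (\<integral>w. ((2 + U w) / c) *\<^sub>R indicator A (X w) \<partial>M)"
    unfolding T_def using wpos
    by (subst integral_distr; simp?) (subst integral_density; simp)
  also have "\<dots> = (\<integral>w. (2 * indicator A (X w) + indicator A (X w) * U w) / c \<partial>M)"
    by (intro Bochner_Integration.integral_cong) (auto simp: field_simps)
  also have "\<dots> = (2 * (\<integral>w. indicator A (X w) \<partial>M) + (\<integral>w. indicator A (X w) * U w \<partial>M)) / c"
    using j1 j2 by simp
  finally show "measure T A = (2 * (\<integral>w. indicator A (X w) \<partial>M) + (\<integral>w. indicator A (X w) * U w \<partial>M)) / c" .
qed

lemma real_weighted_Levy_uniqueness:
  fixes M :: "'w measure" and N :: "'z measure"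
    and X U :: "'w \<Rightarrow> real" and Y W :: "'z \<Rightarrow> real"
  assumes M: "prob_space M" and N: "prob_space N"
    and X: "X \<in> borel_measurable M" and Y: "Y \<in> borel_measurable N"
    and U: "U \<in> borel_measurable M" "\<And>w. \<bar>U w\<bar> \<le> 1"
    and W: "W \<in> borel_measurable N" "\<And>w. \<bar>W w\<bar> \<le> 1"
    and plain: "\<And>s. (CLINT w|M. iexp (s * X w)) = (CLINT w|N. iexp (s * Y w))"
    and weighted: "\<And>s. (CLINT w|M. iexp (s * X w) * of_real (U w)) = (CLINT w|N. iexp (s * Y w) * of_real (W w))"
    and A: "A \<in> sets borel"
  shows "(\<integral>w. indicator A (X w) * U w \<partial>M) = (\<integral>w. indicator A (Y w) * W w \<partial>N)"
proof -
  \<comment> \<open>The weight 2 + U mixes the wanted integral with the unweighted one; the case U = 0 gives the latter.\<close>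
  have eq: "2 * (\<integral>w. indicator A (X w) \<partial>M) + (\<integral>w. indicator A (X w) * U w \<partial>M)
          = 2 * (\<integral>w. indicator A (Y w) \<partial>N) + (\<integral>w. indicator A (Y w) * W w \<partial>N)"
    if U: "U \<in> borel_measurable M" "\<And>w. \<bar>U w\<bar> \<le> 1"
      and W: "W \<in> borel_measurable N" "\<And>w. \<bar>W w\<bar> \<le> 1"
      and weighted: "\<And>s. (CLINT w|M. iexp (s * X w) * of_real (U w)) = (CLINT w|N. iexp (s * Y w) * of_real (W w))"
    for U W
  proof -
    note TM = tilted_law[OF M X U] and TN = tilted_law[OF N Y W]
    have "of_real (\<integral>w. U w \<partial>M) = (of_real (\<integral>w. W w \<partial>N) :: complex)"
      using weighted[of 0] by simp
    then have c: "(\<integral>w. U w \<partial>M) = (\<integral>w. W w \<partial>N)"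
      by (simp only: of_real_eq_iff)
    let ?S = "distr (density M (\<lambda>w. ennreal ((2 + U w) / (2 + (\<integral>w. U w \<partial>M))))) borel X"
    let ?T = "distr (density N (\<lambda>w. ennreal ((2 + W w) / (2 + (\<integral>w. W w \<partial>N))))) borel Y"
    have "char ?S s = char ?T s" for s
      unfolding TM(2) TN(2) unfolding plain weighted c by (rule refl)
    then have "?S = ?T"
      by (intro Levy_uniqueness TM(1) TN(1)) (rule ext)
    then have "measure ?S A = measure ?T A"
      by (rule arg_cong)
    then show ?thesis
      unfolding TM(3)[OF A] TN(3)[OF A] using TN(4) unfolding c by (simp only: divide_cancel_right) auto
  qed
  have "2 * (\<integral>w. indicator A (X w) \<partial>M) + (\<integral>w. indicator A (X w) * 0 \<partial>M)
      = (2::real) * (\<integral>w. indicator A (Y w) \<partial>N) + (\<integral>w. indicator A (Y w) * 0 \<partial>N)"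
    by (rule eq) simp_all
  then show ?thesis
    using eq[OF U W weighted] by (simp only: mult_zero_right Bochner_Integration.integral_zero)
qed

lemma weighted_Levy_uniqueness:
  fixes M :: "'w measure" and N :: "'z measure"
    and X :: "'w \<Rightarrow> real" and Y :: "'z \<Rightarrow> real"
    and U :: "'w \<Rightarrow> complex" and W :: "'z \<Rightarrow> complex"
  assumes M: "prob_space M" and N: "prob_space N"
    and X[measurable]: "X \<in> borel_measurable M" and Y[measurable]: "Y \<in> borel_measurable N"
    and U[measurable]: "U \<in> borel_measurable M" and U1: "\<And>w. norm (U w) \<le> 1"
    and W[measurable]: "W \<in> borel_measurable N" and W1: "\<And>w. norm (W w) \<le> 1"
    and plain: "\<And>s. (CLINT w|M. iexp (s * X w)) = (CLINT w|N. iexp (s * Y w))"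
    and weighted: "\<And>s. (CLINT w|M. iexp (s * X w) * U w) = (CLINT w|N. iexp (s * Y w) * W w)"
    and A[measurable]: "A \<in> sets borel"
  shows "(CLINT w|M. indicator A (X w) * U w) = (CLINT w|N. indicator A (Y w) * W w)"
proof -
  interpret M: prob_space M by fact
  interpret N: prob_space N by fact
  \<comment> \<open>Conjugating the hypothesis at -s gives it for the conjugate weight, hence for real and imaginary parts.\<close>
  have cnj: "(CLINT w|M. iexp (s * X w) * cnj (U w)) = (CLINT w|N. iexp (s * Y w) * cnj (W w))" for s
  proof -
    have e: "iexp (s * x) * cnj z = cnj (iexp (-s * x) * z)" for x :: real and z
      by (simp only: complex_cnj_mult exp_cnj) simp
    have "(CLINT w|M. iexp (s * X w) * cnj (U w)) = cnj (CLINT w|M. iexp (-s * X w) * U w)"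
      unfolding e by (rule Bochner_Integration.integral_cnj)
    also have "\<dots> = cnj (CLINT w|N. iexp (-s * Y w) * W w)"
      by (simp only: weighted)
    also have "\<dots> = (CLINT w|N. iexp (s * Y w) * cnj (W w))"
      unfolding e by (rule Bochner_Integration.integral_cnj[symmetric])
    finally show ?thesis .
  qed
  have [measurable]: "(\<lambda>w. cnj (U w)) \<in> borel_measurable M" "(\<lambda>w. cnj (W w)) \<in> borel_measurable N"
    by (auto intro: borel_measurable_continuous_on[OF continuous_on_cnj[OF continuous_on_id]])
  have iM: "integrable M (\<lambda>w. iexp (s * X w) * U w)" "integrable M (\<lambda>w. iexp (s * X w) * cnj (U w))" for s
    using U1 by (auto intro!: M.integrable_const_bound[where B=1] simp: norm_mult)
  have iN: "integrable N (\<lambda>w. iexp (s * Y w) * W w)" "integrable N (\<lambda>w. iexp (s * Y w) * cnj (W w))" for s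
    using W1 by (auto intro!: N.integrable_const_bound[where B=1] simp: norm_mult)
  have re: "of_real (Re z) = (z + cnj z) / 2" and im: "of_real (Im z) = (z - cnj z) * (- \<i> / 2)" for z :: complex
    by (auto simp: complex_eq_iff)
  have bRe: "\<bar>Re (U w)\<bar> \<le> 1" and bIm: "\<bar>Im (U w)\<bar> \<le> 1" for w
    using U1[of w] abs_Re_le_cmod[of "U w"] abs_Im_le_cmod[of "U w"] by linarith+
  have bRe': "\<bar>Re (W w)\<bar> \<le> 1" and bIm': "\<bar>Im (W w)\<bar> \<le> 1" for w
    using W1[of w] abs_Re_le_cmod[of "W w"] abs_Im_le_cmod[of "W w"] by linarith+
  have "(CLINT w|M. iexp (s * X w) * of_real (Re (U w))) = (CLINT w|N. iexp (s * Y w) * of_real (Re (W w)))" for s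
    unfolding re using iM[of s] iN[of s] weighted[of s] cnj[of s] by (simp add: distrib_left add_divide_distrib)
  then have Re: "(\<integral>w. indicator A (X w) * Re (U w) \<partial>M) = (\<integral>w. indicator A (Y w) * Re (W w) \<partial>N)"
    using bRe bRe' by (intro real_weighted_Levy_uniqueness M N X Y plain A) auto
  have "(CLINT w|M. iexp (s * X w) * of_real (Im (U w))) = (CLINT w|N. iexp (s * Y w) * of_real (Im (W w)))" for s
    unfolding im mult.assoc[symmetric] using iM[of s] iN[of s] weighted[of s] cnj[of s]
    by (simp add: right_diff_distrib)
  then have Im: "(\<integral>w. indicator A (X w) * Im (U w) \<partial>M) = (\<integral>w. indicator A (Y w) * Im (W w) \<partial>N)"
    using bIm bIm' by (intro real_weighted_Levy_uniqueness M N X Y plain A) auto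
  have jM: "integrable M (\<lambda>w. indicator A (X w) * U w)"
    using U1 by (auto intro!: M.integrable_const_bound[where B=1] split: split_indicator)
  have jN: "integrable N (\<lambda>w. indicator A (Y w) * W w)"
    using W1 by (auto intro!: N.integrable_const_bound[where B=1] split: split_indicator)
  have ri: "Re (indicator A x) = indicator A x" "Im (indicator A x) = 0" for x
    by (auto split: split_indicator)
  show ?thesis
    using Re Im jM jN by (intro complex_eqI) (simp_all add: ri flip: integral_Re integral_Im)
qed

text \<open>The multivariate uniqueness theorem for characteristic functions, obtained by treating one coordinate
  at a time. For finite \<open>J\<close>, coordinates in \<open>J\<close> enter through indicators of \<open>X i \<in> A i\<close> and those in a
  disjoint set \<open>H\<close> through an exponential. At first \<open>J\<close> is empty, which is the hypothesis; each step
  moves an index from \<open>H\<close> to \<open>J\<close> by the one-dimensional theorem, in which all other factors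
  form the weight. At the end \<open>H\<close> is empty and the equation is about cylinder sets, which generate
  the product sigma-algebra.\<close>

proposition process_law_eqI:
  fixes M :: "'w measure" and N :: "'z measure"
    and X :: "'i \<Rightarrow> 'w \<Rightarrow> real" and Y :: "'i \<Rightarrow> 'z \<Rightarrow> real"
  assumes M: "prob_space M" and N: "prob_space N"
    and X[measurable]: "\<And>i. i \<in> I \<Longrightarrow> X i \<in> borel_measurable M"
    and Y[measurable]: "\<And>i. i \<in> I \<Longrightarrow> Y i \<in> borel_measurable N"
    and char: "\<And>J t. finite J \<Longrightarrow> J \<subseteq> I \<Longrightarrow>
      (CLINT w|M. iexp (\<Sum>i\<in>J. t i * X i w)) = (CLINT w|N. iexp (\<Sum>i\<in>J. t i * Y i w))"
  shows "distr M (\<Pi>\<^sub>M i\<in>I. borel) (\<lambda>w. \<lambda>i\<in>I. X i w) = distr N (\<Pi>\<^sub>M i\<in>I. borel) (\<lambda>w. \<lambda>i\<in>I. Y i w)"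
    (is "?P = ?Q")
proof (rule measure_eqI_PiM_infinite[where M="\<lambda>_. borel"])
  interpret M: prob_space M by fact
  interpret N: prob_space N by fact
  have P: "prob_space ?P"
    by (rule M.prob_space_distr) simp
  then show "finite_measure ?P"
    by (simp add: prob_space.finite_measure)
  have joint: "(CLINT w|M. (\<Prod>i\<in>J. indicator (A i) (X i w)) * iexp (\<Sum>i\<in>H. t i * X i w)) =
               (CLINT w|N. (\<Prod>i\<in>J. indicator (A i) (Y i w)) * iexp (\<Sum>i\<in>H. t i * Y i w))"
    if "finite J" "J \<subseteq> I" "finite H" "H \<subseteq> I" "H \<inter> J = {}" "\<And>i. i \<in> J \<Longrightarrow> A i \<in> sets borel" for J H A t
    using that
  proof (induction J arbitrary: H t rule: finite_induct)
    case empty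
    then show ?case
      using char[of H t] by simp
  next
    case (insert j J)
    have j: "j \<in> I" and JI: "\<And>i. i \<in> J \<Longrightarrow> i \<in> I" and HI: "\<And>i. i \<in> H \<Longrightarrow> i \<in> I" and jH: "j \<notin> H"
      using insert.prems by auto
    have [measurable]: "A j \<in> sets borel" "\<And>i. i \<in> J \<Longrightarrow> A i \<in> sets borel"
      using insert.prems by auto
    note [measurable] = j JI HI
    have prod_le: "norm (\<Prod>i\<in>J. indicator (A i) (f i) :: complex) \<le> 1" for f :: "'i \<Rightarrow> real"
      unfolding prod_norm[symmetric] by (intro prod_le_1) (auto split: split_indicator)
    have "(CLINT w|M. indicator (A j) (X j w) * ((\<Prod>i\<in>J. indicator (A i) (X i w)) * iexp (\<Sum>i\<in>H. t i * X i w))) =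
          (CLINT w|N. indicator (A j) (Y j w) * ((\<Prod>i\<in>J. indicator (A i) (Y i w)) * iexp (\<Sum>i\<in>H. t i * Y i w)))"
    proof (rule weighted_Levy_uniqueness[OF M N])
      show "(CLINT w|M. iexp (s * X j w)) = (CLINT w|N. iexp (s * Y j w))" for s
        using char[of "{j}" "\<lambda>_. s"] j by simp
      show "(CLINT w|M. iexp (s * X j w) * ((\<Prod>i\<in>J. indicator (A i) (X i w)) * iexp (\<Sum>i\<in>H. t i * X i w))) =
            (CLINT w|N. iexp (s * Y j w) * ((\<Prod>i\<in>J. indicator (A i) (Y i w)) * iexp (\<Sum>i\<in>H. t i * Y i w)))" for s
      proof -
        have sum: "(\<Sum>i\<in>insert j H. (t(j := s)) i * f i) = s * f j + (\<Sum>i\<in>H. t i * f i)" for f :: "'i \<Rightarrow> real"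
          using insert.prems jH by (auto intro!: sum.cong)
        have ex: "(p :: complex) * iexp (x + y) = iexp x * (p * iexp y)" for p and x y :: real
          by (simp add: distrib_left exp_add)
        show ?thesis
          using insert.IH[of "insert j H" "t(j := s)"] insert.prems insert.hyps
          unfolding sum ex by auto
      qed
    qed (use j prod_le in \<open>auto simp: norm_mult\<close>)
    then show ?case
      using insert.hyps by (simp add: mult.assoc)
  qed
  fix A :: "'i \<Rightarrow> real set" and J
  assume J: "finite J" "J \<subseteq> I" and A: "\<And>i. i \<in> J \<Longrightarrow> A i \<in> sets borel"
  let ?E = "prod_emb I (\<lambda>_. borel) J (Pi\<^sub>E J A)"
  have E[measurable]: "?E \<in> sets (\<Pi>\<^sub>M i\<in>I. borel)"
    using J A by (intro sets_PiM_I) auto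
  have Q: "prob_space ?Q"
    by (rule N.prob_space_distr) simp
  have ind: "of_real (indicator ?E (\<lambda>i\<in>I. f i)) = (\<Prod>i\<in>J. indicator (A i) (f i) :: complex)" for f :: "'i \<Rightarrow> real"
  proof (cases "\<forall>i\<in>J. f i \<in> A i")
    case True
    then have "(\<lambda>i\<in>I. f i) \<in> ?E"
      using J by (auto simp: prod_emb_def restrict_def PiE_iff extensional_def)
    then show ?thesis using True by simp
  next
    case False
    then obtain i where i: "i \<in> J" "f i \<notin> A i" by auto
    then have "(\<lambda>i\<in>I. f i) \<notin> ?E"
      using J by (auto simp: prod_emb_def PiE_iff)
    moreover have "(\<Prod>i\<in>J. indicator (A i) (f i) :: complex) = 0"
      using i J by (auto intro!: prod_zero bexI[of _ i])
    ultimately show ?thesis by simp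
  qed
  have "of_real (measure ?P ?E) = (CLINT w|M. (\<Prod>i\<in>J. indicator (A i) (X i w)))"
  proof -
    have "measure ?P ?E = (\<integral>w. indicator ?E (\<lambda>i\<in>I. X i w) \<partial>M)"
      by (subst integral_distr[symmetric, where N="\<Pi>\<^sub>M i\<in>I. borel"]) auto
    then show ?thesis
      by (simp add: ind flip: integral_complex_of_real)
  qed
  moreover have "of_real (measure ?Q ?E) = (CLINT w|N. (\<Prod>i\<in>J. indicator (A i) (Y i w)))"
  proof -
    have "measure ?Q ?E = (\<integral>w. indicator ?E (\<lambda>i\<in>I. Y i w) \<partial>N)"
      by (subst integral_distr[symmetric, where N="\<Pi>\<^sub>M i\<in>I. borel"]) auto
    then show ?thesis
      by (simp add: ind flip: integral_complex_of_real)
  qed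
  ultimately have "of_real (measure ?P ?E) = (of_real (measure ?Q ?E) :: complex)"
    using joint[of J "{}" A "\<lambda>_. 0"] J A by simp
  then show "emeasure ?P ?E = emeasure ?Q ?E"
    using P Q by (simp add: finite_measure.emeasure_eq_measure prob_space.finite_measure)
qed (auto)


section \<open>Null sets of shifted white noise\<close>

lemma normal_density_std_image:
  assumes "0 < \<sigma>"
  shows "density lborel (normal_density 0 \<sigma>) = distr std_normal_distribution borel (\<lambda>x. \<sigma> * x)"
proof -
  interpret prob_space std_normal_distribution
    by (rule real_dist_normal_dist[THEN real_distribution.axioms(1)])
  have "distr std_normal_distribution lborel (\<lambda>x. x) = std_normal_distribution"
    by (intro distr_id2) simp
  then have "distributed std_normal_distribution lborel (\<lambda>x. x) std_normal_density"
    by (simp add: distributed_def)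
  from normal_density_affine[OF this, of \<sigma> 0] assms show ?thesis
    by (simp add: distributed_def cong: distr_cong)
qed

lemma centered_normal_char:
  assumes "0 \<le> \<sigma>"
  shows "(CLINT x|centered_normal \<sigma>. iexp x) = of_real (exp (- \<sigma>\<^sup>2 / 2))"
proof (cases "\<sigma> = 0")
  case True
  then show ?thesis
    by (simp add: centered_normal_def integral_return)
next
  case False
  with assms have "0 < \<sigma>" by simp
  with False have "(CLINT x|centered_normal \<sigma>. iexp x) = char std_normal_distribution \<sigma>"
    unfolding centered_normal_def by (simp only: if_False normal_density_std_image[of \<sigma>])
      (subst integral_distr; simp add: char_def)
  then show ?thesis
    by (simp add: char_std_normal_distribution)
qed

lemma white_noise_char:
  assumes noise: "white_noise M V \<Xi>" and J: "finite J" "J \<subseteq> V"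
  shows "(CLINT w|M. iexp (\<Sum>\<phi>\<in>J. c \<phi> * \<Xi> \<phi> w)) = of_real (exp (- (norm (\<Sum>\<phi>\<in>J. c \<phi> *\<^sub>R \<phi>))\<^sup>2 / 2))"
proof -
  have [measurable]: "\<And>\<phi>. \<phi> \<in> J \<Longrightarrow> \<Xi> \<phi> \<in> borel_measurable M"
    and law: "distr M borel (\<lambda>w. \<Sum>\<phi>\<in>J. c \<phi> * \<Xi> \<phi> w) =
      centered_normal (sqrt (\<Sum>\<phi>\<in>J. \<Sum>\<psi>\<in>J. c \<phi> * c \<psi> * inner \<phi> \<psi>))"
    using noise J by (auto simp: white_noise_def)
  have "(\<Sum>\<phi>\<in>J. \<Sum>\<psi>\<in>J. c \<phi> * c \<psi> * inner \<phi> \<psi>) = (norm (\<Sum>\<phi>\<in>J. c \<phi> *\<^sub>R \<phi>))\<^sup>2"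
    unfolding power2_norm_eq_inner inner_sum_left inner_sum_right inner_scaleR_left inner_scaleR_right
    by (intro sum.cong refl) (simp add: inner_commute sum_distrib_left mult.assoc)
  then have "distr M borel (\<lambda>w. \<Sum>\<phi>\<in>J. c \<phi> * \<Xi> \<phi> w) = centered_normal (norm (\<Sum>\<phi>\<in>J. c \<phi> *\<^sub>R \<phi>))"
    using law by simp
  then have "(CLINT x|distr M borel (\<lambda>w. \<Sum>\<phi>\<in>J. c \<phi> * \<Xi> \<phi> w). iexp x) =
      of_real (exp (- (norm (\<Sum>\<phi>\<in>J. c \<phi> *\<^sub>R \<phi>))\<^sup>2 / 2))"
    by (simp only: centered_normal_char[OF norm_ge_zero])
  then show ?thesis
    by (subst (asm) integral_distr) auto
qed

text \<open>The component of the noise orthogonal to \<open>h\<close> is independent of \<open>\<Xi> h\<close>, so redrawing \<open>\<Xi> h\<close> does not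
  change the joint law. In terms of characteristic functions: for a linear combination with coefficient
  vector \<open>x\<close> and \<open>q = inner x h\<close>, the retained part has variance \<open>norm (x - q h)\<^sup>2\<close>, the fresh part has
  variance \<open>q\<^sup>2\<close>, and the two add up to \<open>norm x ^ 2\<close> by Pythagoras.\<close>

proposition white_noise_refresh_direction:
  fixes \<Xi> :: "'v::real_inner \<Rightarrow> 'w \<Rightarrow> real"
  assumes noise: "white_noise M V \<Xi>" and h: "h \<in> V" "norm h = 1"
  shows "distr M (data_space V) (\<lambda>w. \<lambda>\<phi>\<in>V. \<Xi> \<phi> w) =
    distr (M \<Otimes>\<^sub>M std_normal_distribution) (data_space V)
      (\<lambda>p. \<lambda>\<phi>\<in>V. \<Xi> \<phi> (fst p) + inner \<phi> h * (snd p - \<Xi> h (fst p)))"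
proof (rule process_law_eqI)
  have M: "prob_space M" and meas[measurable]: "\<And>\<phi>. \<phi> \<in> V \<Longrightarrow> \<Xi> \<phi> \<in> borel_measurable M"
    using noise by (auto simp: white_noise_def)
  have S: "prob_space std_normal_distribution"
    by (rule real_dist_normal_dist[THEN real_distribution.axioms(1)])
  note [measurable] = h(1)
  show "prob_space M" "prob_space (M \<Otimes>\<^sub>M std_normal_distribution)"
    using M S by (auto intro: prob_space_pair)
  interpret M: prob_space M by fact
  interpret S: prob_space std_normal_distribution by fact
  interpret pair_prob_space M std_normal_distribution ..
  show "\<And>\<phi>. \<phi> \<in> V \<Longrightarrow> \<Xi> \<phi> \<in> borel_measurable M"
    "\<And>\<phi>. \<phi> \<in> V \<Longrightarrow> (\<lambda>p. \<Xi> \<phi> (fst p) + inner \<phi> h * (snd p - \<Xi> h (fst p))) \<in>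
      borel_measurable (M \<Otimes>\<^sub>M std_normal_distribution)"
    by measurable
  fix J :: "'v set" and t
  assume J: "finite J" "J \<subseteq> V"
  then have [measurable]: "\<And>\<phi>. \<phi> \<in> J \<Longrightarrow> \<Xi> \<phi> \<in> borel_measurable M"
    by auto
  then have [measurable]: "\<And>\<phi>. \<phi> \<in> insert h J \<Longrightarrow> \<Xi> \<phi> \<in> borel_measurable M"
    using h(1) by auto
  define x where "x = (\<Sum>\<phi>\<in>J. t \<phi> *\<^sub>R \<phi>)"
  define q where "q = inner x h"
  have q: "q = (\<Sum>\<phi>\<in>J. t \<phi> * inner \<phi> h)"
    by (simp add: q_def x_def inner_sum_left)
  \<comment> \<open>The retained part as one linear combination over J and h; the two terms are needed as h may lie in J.\<close>
  define c where "c \<phi> = (if \<phi> \<in> J then t \<phi> else 0) - (if \<phi> = h then q else 0)" for \<phi>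
  have split: "(\<Sum>\<phi>\<in>insert h J. f (c \<phi>) \<phi>) = (\<Sum>\<phi>\<in>J. f (t \<phi>) \<phi>) - f q h"
    if f: "\<And>a b \<phi>. f (a - b) \<phi> = f a \<phi> - f b \<phi>" for f :: "real \<Rightarrow> 'v \<Rightarrow> 'e::real_vector"
  proof -
    have f0: "f 0 \<phi> = 0" for \<phi>
      using f[of 0 0] by simp
    have "(\<Sum>\<phi>\<in>insert h J. f (c \<phi>) \<phi>) =
        (\<Sum>\<phi>\<in>insert h J. if \<phi> \<in> J then f (t \<phi>) \<phi> else 0) - (\<Sum>\<phi>\<in>insert h J. if \<phi> = h then f q \<phi> else 0)"
      unfolding sum_subtractf[symmetric] by (intro sum.cong refl) (auto simp: c_def f f0)
    also have "(\<Sum>\<phi>\<in>insert h J. if \<phi> \<in> J then f (t \<phi>) \<phi> else 0) = (\<Sum>\<phi>\<in>J. f (t \<phi>) \<phi>)"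
      using J by (intro sum.mono_neutral_cong_right) auto
    also have "(\<Sum>\<phi>\<in>insert h J. if \<phi> = h then f q \<phi> else 0) = f q h"
      using J by (subst sum.delta) auto
    finally show ?thesis .
  qed
  have comb: "(\<Sum>\<phi>\<in>insert h J. c \<phi> *\<^sub>R \<phi>) = x - q *\<^sub>R h"
    unfolding x_def by (rule split) (rule scaleR_left_diff_distrib)
  have process: "(\<Sum>\<phi>\<in>insert h J. c \<phi> * \<Xi> \<phi> w) = (\<Sum>\<phi>\<in>J. t \<phi> * \<Xi> \<phi> w) - q * \<Xi> h w" for w
    by (rule split) (rule left_diff_distrib)
  have pyth: "(norm x)\<^sup>2 = (norm (x - q *\<^sub>R h))\<^sup>2 + q\<^sup>2"
    using h(2) unfolding power2_norm_eq_inner q_def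
    by (simp add: inner_diff_left inner_diff_right inner_commute power2_eq_square flip: norm_eq_1)
  have resampled: "(\<Sum>\<phi>\<in>J. t \<phi> * (\<Xi> \<phi> w + inner \<phi> h * (z - \<Xi> h w))) =
      (\<Sum>\<phi>\<in>insert h J. c \<phi> * \<Xi> \<phi> w) + q * z" for w z
  proof -
    have "(\<Sum>\<phi>\<in>J. t \<phi> * (\<Xi> \<phi> w + inner \<phi> h * (z - \<Xi> h w))) =
        (\<Sum>\<phi>\<in>J. t \<phi> * \<Xi> \<phi> w) + q * (z - \<Xi> h w)"
      by (simp add: q sum_distrib_right distrib_left sum.distrib mult.assoc)
    then show ?thesis
      by (simp add: process right_diff_distrib)
  qed
  have "(CLINT p|M \<Otimes>\<^sub>M std_normal_distribution.
        iexp (\<Sum>\<phi>\<in>J. t \<phi> * (\<Xi> \<phi> (fst p) + inner \<phi> h * (snd p - \<Xi> h (fst p))))) =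
      (CLINT w|M. CLINT z|std_normal_distribution. iexp ((\<Sum>\<phi>\<in>insert h J. c \<phi> * \<Xi> \<phi> w) + q * z))"
    unfolding resampled by (subst integral_fst'[symmetric]) (auto intro!: integrable_const_bound[where B=1])
  also have "\<dots> = (CLINT w|M. iexp (\<Sum>\<phi>\<in>insert h J. c \<phi> * \<Xi> \<phi> w) * char std_normal_distribution q)"
    by (simp only: of_real_add distrib_left exp_add Bochner_Integration.integral_mult_right_zero char_def)
  also have "\<dots> = of_real (exp (- (norm (x - q *\<^sub>R h))\<^sup>2 / 2)) * of_real (exp (- q\<^sup>2 / 2))"
    using white_noise_char[OF noise, of "insert h J" c] J h(1)
    by (simp only: Bochner_Integration.integral_mult_left_zero comb char_std_normal_distribution) simp
  also have "\<dots> = of_real (exp (- (norm x)\<^sup>2 / 2))"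
    unfolding of_real_mult[symmetric] exp_add[symmetric] pyth by (simp add: field_simps)
  also have "\<dots> = (CLINT w|M. iexp (\<Sum>\<phi>\<in>J. t \<phi> * \<Xi> \<phi> w))"
    using white_noise_char[OF noise J, of t] by (simp add: x_def)
  finally show "(CLINT w|M. iexp (\<Sum>\<phi>\<in>J. t \<phi> * \<Xi> \<phi> w)) =
      (CLINT p|M \<Otimes>\<^sub>M std_normal_distribution.
        iexp (\<Sum>\<phi>\<in>J. t \<phi> * (\<Xi> \<phi> (fst p) + inner \<phi> h * (snd p - \<Xi> h (fst p)))))" ..
qed

text \<open>With the noise in the direction \<open>h\<close> represented by an independent standard normal \<open>z\<close>, adding \<open>a h\<close> to
  the signal is the same as translating \<open>z\<close> by \<open>a / r\<close>, where \<open>r\<close> is the noise level. By Fubini it is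
  enough to know that translation preserves null sets of the normal law on the line, and these are
  the Lebesgue null sets since the density is positive.\<close>

lemma absolutely_continuous_unit_shift:
  fixes \<Xi> :: "'v::real_inner \<Rightarrow> 'w \<Rightarrow> real"
  assumes noise: "white_noise M V \<Xi>" and n: "0 < n" and h: "h \<in> V" "norm h = 1"
  shows "absolutely_continuous (data_law M \<Xi> V n \<theta>) (data_law M \<Xi> V n (\<theta> + a *\<^sub>R h))"
proof -
  have M: "prob_space M" and meas[measurable]: "\<And>\<phi>. \<phi> \<in> V \<Longrightarrow> \<Xi> \<phi> \<in> borel_measurable M"
    using noise by (auto simp: white_noise_def)
  note [measurable] = h(1)
  have S: "prob_space std_normal_distribution"
    by (rule real_dist_normal_dist[THEN real_distribution.axioms(1)])
  interpret M: prob_space M by fact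
  interpret S: prob_space std_normal_distribution by fact
  interpret pair_prob_space M std_normal_distribution ..
  define r where "r = real n powr (-1/2)"
  have r: "0 < r"
    using n by (simp add: r_def)
  define G where "G \<eta> p = (\<lambda>\<phi>\<in>V. inner \<eta> \<phi> + r * (\<Xi> \<phi> (fst p) + inner \<phi> h * (snd p - \<Xi> h (fst p))))" for \<eta> p
  have G[measurable]: "G \<eta> \<in> M \<Otimes>\<^sub>M std_normal_distribution \<rightarrow>\<^sub>M data_space V" for \<eta>
    unfolding G_def by measurable
  have law: "data_law M \<Xi> V n \<eta> = distr (M \<Otimes>\<^sub>M std_normal_distribution) (data_space V) (G \<eta>)" for \<eta>
  proof -
    let ?affine = "\<lambda>y. \<lambda>\<phi>\<in>V. inner \<eta> \<phi> + r * y \<phi>"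
    have affine: "?affine \<in> data_space V \<rightarrow>\<^sub>M data_space V"
      by measurable
    have noise_meas: "(\<lambda>w. \<lambda>\<phi>\<in>V. \<Xi> \<phi> w) \<in> M \<rightarrow>\<^sub>M data_space V"
      "(\<lambda>p. \<lambda>\<phi>\<in>V. \<Xi> \<phi> (fst p) + inner \<phi> h * (snd p - \<Xi> h (fst p))) \<in>
        M \<Otimes>\<^sub>M std_normal_distribution \<rightarrow>\<^sub>M data_space V"
      by measurable
    have "data_law M \<Xi> V n \<eta> = distr (distr M (data_space V) (\<lambda>w. \<lambda>\<phi>\<in>V. \<Xi> \<phi> w)) (data_space V) ?affine"
      unfolding data_law_def r_def[symmetric] distr_distr[OF affine noise_meas(1)]
      by (intro distr_cong) (auto simp: restrict_def)
    then show ?thesis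
      unfolding white_noise_refresh_direction[OF noise h] distr_distr[OF affine noise_meas(2)]
      by (simp only:) (intro distr_cong; auto simp: G_def restrict_def)
  qed
  have G_shift: "G (\<theta> + a *\<^sub>R h) (w, z) = G \<theta> (w, a / r + z)" for w z
    using r by (auto simp: G_def restrict_def fun_eq_iff inner_add_left inner_commute[of h] field_simps)
  show ?thesis
    unfolding absolutely_continuous_def
  proof
    fix A assume A: "A \<in> null_sets (data_law M \<Xi> V n \<theta>)"
    then have As[measurable]: "A \<in> sets (data_space V)"
      by (simp add: data_law_def null_sets_def)
    have "AE p in M \<Otimes>\<^sub>M std_normal_distribution. G \<theta> p \<notin> A"
      using AE_not_in[OF A] unfolding law by (subst (asm) AE_distr_iff) auto
    from AE_pair[OF this] AE_space have "AE w in M. AE z in std_normal_distribution. G (\<theta> + a *\<^sub>R h) (w, z) \<notin> A"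
    proof eventually_elim
      case (elim w)
      then have w: "w \<in> space M" by simp
      have [measurable]: "(\<lambda>z. G \<theta> (w, z)) \<in> borel \<rightarrow>\<^sub>M data_space V"
        using measurable_compose[OF measurable_Pair1'[OF w] G[of \<theta>]] by simp
      have "AE z in lborel. G \<theta> (w, z) \<notin> A"
        using elim(1)
        by (subst (asm) AE_density) (auto simp: normal_density_pos)
      then have "AE z in lborel. G \<theta> (w, a / r + 1 * z) \<notin> A"
        by (intro AE_borel_affine) auto
      then show ?case
        by (subst AE_density) (auto simp: G_shift)
    qed
    then have "AE p in M \<Otimes>\<^sub>M std_normal_distribution. G (\<theta> + a *\<^sub>R h) p \<notin> A"
      by (rule AE_pair_measure[rotated]) measurable
    then have "AE y in data_law M \<Xi> V n (\<theta> + a *\<^sub>R h). y \<notin> A"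
      unfolding law by (subst AE_distr_iff) auto
    then show "A \<in> null_sets (data_law M \<Xi> V n (\<theta> + a *\<^sub>R h))"
      by (subst (asm) AE_iff_null_sets[symmetric]) (auto simp: data_law_def)
  qed
qed

text \<open>The qualitative half of the Cameron-Martin theorem. The scalar \<open>c\<close> in the hypothesis provides the unit
  vector in the direction of the shift.\<close>

proposition data_law_absolutely_continuous:
  assumes noise: "white_noise M V \<Xi>" and n: "0 < n"
    and diff: "\<And>c. c *\<^sub>R (\<theta>' - \<theta>) \<in> V"
  shows "absolutely_continuous (data_law M \<Xi> V n \<theta>) (data_law M \<Xi> V n \<theta>')"
proof (cases "\<theta>' = \<theta>")
  case True
  then show ?thesis by (simp add: absolutely_continuous_def)
next
  case False
  then have "absolutely_continuous (data_law M \<Xi> V n \<theta>)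
      (data_law M \<Xi> V n (\<theta> + norm (\<theta>' - \<theta>) *\<^sub>R (inverse (norm (\<theta>' - \<theta>)) *\<^sub>R (\<theta>' - \<theta>))))"
    by (intro absolutely_continuous_unit_shift noise n diff) simp
  with False show ?thesis by simp
qed


section \<open>Laws of the data\<close>

text \<open>The laws of the data form a probability kernel, so that the marginal law of the data exists as a
  monadic bind of prior and kernel.\<close>

lemma data_law_kernel:
  assumes noise: "white_noise M V \<Xi>"
    and \<theta>: "\<And>\<phi>. \<phi> \<in> V \<Longrightarrow> (\<lambda>v. inner (\<theta> v) \<phi>) \<in> borel_measurable N"
  shows "(\<lambda>v. data_law M \<Xi> V n (\<theta> v)) \<in> N \<rightarrow>\<^sub>M prob_algebra (data_space V)"
  unfolding data_law_def
proof (rule measurable_distr_prob_space2)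
  have [measurable]: "\<And>\<phi>. \<phi> \<in> V \<Longrightarrow> \<Xi> \<phi> \<in> borel_measurable M" and M: "prob_space M"
    using noise by (auto simp: white_noise_def)
  show "(\<lambda>v. M) \<in> N \<rightarrow>\<^sub>M prob_algebra M"
    using M by (intro measurable_const) (simp add: space_prob_algebra)
  have [measurable]: "(\<lambda>p. inner (\<theta> (fst p)) \<phi>) \<in> borel_measurable (N \<Otimes>\<^sub>M M)" if "\<phi> \<in> V" for \<phi>
    using measurable_compose[OF measurable_fst \<theta>[OF that]] .
  show "(\<lambda>(v, w). \<lambda>\<phi>\<in>V. inner (\<theta> v) \<phi> + real n powr (- 1 / 2) * \<Xi> \<phi> w) \<in> N \<Otimes>\<^sub>M M \<rightarrow>\<^sub>M data_space V"
    unfolding case_prod_beta by measurable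
qed

lemma data_law_add:
  assumes noise: "white_noise M V \<Xi>"
  shows "data_law M \<Xi> V n (\<theta> + \<eta>) =
    distr (data_law M \<Xi> V n \<theta>) (data_space V) (\<lambda>y. \<lambda>\<phi>\<in>V. y \<phi> + inner \<eta> \<phi>)"
proof -
  have [measurable]: "\<And>\<phi>. \<phi> \<in> V \<Longrightarrow> \<Xi> \<phi> \<in> borel_measurable M"
    using noise by (auto simp: white_noise_def)
  have shift: "(\<lambda>y. \<lambda>\<phi>\<in>V. y \<phi> + inner \<eta> \<phi>) \<in> data_space V \<rightarrow>\<^sub>M data_space V"
    by measurable
  have obs: "(\<lambda>w. \<lambda>\<phi>\<in>V. inner \<theta> \<phi> + real n powr (-1/2) * \<Xi> \<phi> w) \<in> M \<rightarrow>\<^sub>M data_space V"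
    by measurable
  show ?thesis
    unfolding data_law_def distr_distr[OF shift obs]
    by (intro distr_cong) (auto simp: restrict_def inner_add_left)
qed


section \<open>Uniqueness and transformation of posterior distributions\<close>

text \<open>By definition the posterior probability of \<open>E\<close> is a density, with respect to the marginal law of the
  data, of the measure \<open>A \<mapsto> P(parameter in E, data in A)\<close>. Uniqueness is claimed for one event \<open>E\<close> at
  a time, because an exceptional set common to all \<open>E\<close> would call for a countably generated
  sigma-algebra.\<close>

lemma posterior_AE_unique:
  assumes \<pi>: "prob_space \<pi>" and P: "P \<in> \<pi> \<rightarrow>\<^sub>M prob_algebra S"
    and \<kappa>: "is_posterior S \<pi> P \<kappa>" and \<kappa>': "is_posterior S \<pi> P \<kappa>'" and E: "E \<in> sets \<pi>"
  shows "AE y in \<pi> \<bind> P. emeasure (\<kappa> y) E = emeasure (\<kappa>' y) E"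
proof -
  have \<pi>_in: "\<pi> \<in> space (prob_algebra \<pi>)"
    using \<pi> by (simp add: space_prob_algebra)
  have sets: "sets (\<pi> \<bind> P) = sets S" and "prob_space (\<pi> \<bind> P)"
    using sets_bind'[OF \<pi>_in P] prob_space_bind'[OF \<pi>_in P] .
  then interpret prob_space "\<pi> \<bind> P" by simp
  note meas_cong = measurable_cong_sets[OF sets refl]
  have meas: "(\<lambda>y. emeasure (\<rho> y) E) \<in> borel_measurable S" if "is_posterior S \<pi> P \<rho>" for \<rho>
    using that E unfolding is_posterior_def
    by (auto intro: measurable_compose[OF _ measurable_emeasure_subprob_algebra] measurable_prob_algebraD)
  have joint: "(\<integral>\<^sup>+y\<in>A. emeasure (\<rho> y) E \<partial>(\<pi> \<bind> P)) = (\<integral>\<^sup>+\<theta>\<in>E. emeasure (P \<theta>) A \<partial>\<pi>)"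
    if "is_posterior S \<pi> P \<rho>" "A \<in> sets S" for \<rho> A
  proof -
    have "(\<integral>\<^sup>+y\<in>A. emeasure (\<rho> y) E \<partial>(\<pi> \<bind> P)) = (\<integral>\<^sup>+\<theta>. (\<integral>\<^sup>+y\<in>A. emeasure (\<rho> y) E \<partial>P \<theta>) \<partial>\<pi>)"
      using meas[OF that(1)] that(2) P
      by (intro nn_integral_bind[where B=S]) (auto intro: measurable_prob_algebraD)
    then show ?thesis
      using that E by (simp add: is_posterior_def)
  qed
  show ?thesis
    by (rule density_unique_finite_measure)
      (auto simp: meas_cong meas \<kappa> \<kappa>' sets joint)
qed

text \<open>An exceptional set for the marginal law is null under \<open>P \<theta>\<close> for almost all \<open>\<theta>\<close>, in particular for
  some \<open>\<theta>\<close>; domination by that single \<open>P \<theta>\<close> is then enough to make it null under \<open>R\<close>.\<close>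

lemma posterior_AE_unique_dominated:
  assumes \<pi>: "prob_space \<pi>" and P: "P \<in> \<pi> \<rightarrow>\<^sub>M prob_algebra S"
    and \<kappa>: "is_posterior S \<pi> P \<kappa>" and \<kappa>': "is_posterior S \<pi> P \<kappa>'" and E: "E \<in> sets \<pi>"
    and dominated: "\<And>\<theta>. \<theta> \<in> space \<pi> \<Longrightarrow> absolutely_continuous (P \<theta>) R" and R: "sets R = sets S"
  shows "AE y in R. measure (\<kappa> y) E = measure (\<kappa>' y) E"
proof -
  interpret \<pi>: prob_space \<pi> by fact
  have P_sets: "sets (P \<theta>) = sets S" if "\<theta> \<in> space \<pi>" for \<theta>
    using measurable_space[OF P that] by (simp add: space_prob_algebra)
  have \<pi>_in: "\<pi> \<in> space (prob_algebra \<pi>)"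
    using \<pi> by (simp add: space_prob_algebra)
  have "AE y in \<pi> \<bind> P. emeasure (\<kappa> y) E = emeasure (\<kappa>' y) E"
    using posterior_AE_unique[OF \<pi> P \<kappa> \<kappa>' E] .
  then obtain A where A: "{y \<in> space (\<pi> \<bind> P). emeasure (\<kappa> y) E \<noteq> emeasure (\<kappa>' y) E} \<subseteq> A"
      "emeasure (\<pi> \<bind> P) A = 0" "A \<in> sets (\<pi> \<bind> P)"
    by (rule AE_E)
  have AS: "A \<in> sets S" and sp: "space (\<pi> \<bind> P) = space S"
    using A(3) sets_bind'[OF \<pi>_in P] sets_eq_imp_space_eq[OF sets_bind'[OF \<pi>_in P]] by auto
  have "(\<integral>\<^sup>+\<theta>. emeasure (P \<theta>) A \<partial>\<pi>) = 0"
    using A(2) emeasure_bind_prob_algebra[OF \<pi>_in P AS] by simp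
  moreover have "(\<lambda>\<theta>. emeasure (P \<theta>) A) \<in> borel_measurable \<pi>"
    using measurable_compose[OF measurable_prob_algebraD[OF P] measurable_emeasure_subprob_algebra[OF AS]] .
  ultimately have "AE \<theta> in \<pi>. emeasure (P \<theta>) A = 0"
    by (simp add: nn_integral_0_iff_AE)
  then have "\<exists>\<theta>\<in>space \<pi>. emeasure (P \<theta>) A = 0"
    using \<pi>.AE_contr by (metis (mono_tags, lifting) AE_mp AE_I2)
  then obtain \<theta> where \<theta>: "\<theta> \<in> space \<pi>" "emeasure (P \<theta>) A = 0"
    by blast
  then have "A \<in> null_sets R"
    using dominated[OF \<theta>(1)] P_sets[OF \<theta>(1)] AS by (auto simp: absolutely_continuous_def null_sets_def)
  then show ?thesis
    using A(1) sets_eq_imp_space_eq[OF R] unfolding sp by (intro AE_I') (auto simp: measure_def)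
qed

lemma prob_algebra_cong: "sets M = sets N \<Longrightarrow> prob_algebra M = prob_algebra N"
  by (simp add: prob_algebra_def cong: subprob_algebra_cong)

text \<open>Reparametrise by \<open>G\<close> and recode the data by an injective map \<open>T\<close> with measurable left inverse: the
  posterior of the new experiment is the image under \<open>G\<close> of the old posterior at the recoded data. Both
  sides of the defining equation for \<open>A\<close> and \<open>E\<close> are those of the old one for \<open>A'\<close> and \<open>E'\<close>, the preimages
  of \<open>A\<close> under \<open>T'\<close> and of \<open>E\<close> under \<open>G\<close>, by change of variables.\<close>

proposition posterior_pushforward:
  assumes \<kappa>: "is_posterior S \<pi> P \<kappa>" and G: "G \<in> \<pi> \<rightarrow>\<^sub>M N"
    and T: "T \<in> S \<rightarrow>\<^sub>M S" and T': "T' \<in> S \<rightarrow>\<^sub>M S" and inv: "\<And>y. y \<in> space S \<Longrightarrow> T' (T y) = y"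
    and P': "P' \<in> N \<rightarrow>\<^sub>M prob_algebra S" and P: "\<And>\<theta>. \<theta> \<in> space \<pi> \<Longrightarrow> P \<theta> = distr (P' (G \<theta>)) S T"
  shows "is_posterior S (distr \<pi> N G) P' (\<lambda>y. distr (\<kappa> (T y)) N G)"
  unfolding is_posterior_def
proof (intro conjI ballI)
  have \<kappa>_meas: "\<kappa> \<in> S \<rightarrow>\<^sub>M prob_algebra \<pi>"
    using \<kappa> by (simp add: is_posterior_def)
  then have "(\<lambda>y. distr (\<kappa> (T y)) N G) \<in> S \<rightarrow>\<^sub>M prob_algebra N"
    using measurable_compose[OF measurable_compose[OF T \<kappa>_meas] measurable_distr_prob_space[OF G]] by simp
  then show "(\<lambda>y. distr (\<kappa> (T y)) N G) \<in> S \<rightarrow>\<^sub>M prob_algebra (distr \<pi> N G)"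
    by (simp cong: prob_algebra_cong)
  have \<kappa>_sets: "sets (\<kappa> y) = sets \<pi>" if "y \<in> space S" for y
    using measurable_space[OF \<kappa>_meas that] by (simp add: space_prob_algebra)
  fix A E assume A: "A \<in> sets S" and "E \<in> sets (distr \<pi> N G)"
  then have E: "E \<in> sets N" by simp
  define A' where "A' = T' -` A \<inter> space S"
  define E' where "E' = G -` E \<inter> space \<pi>"
  have A': "A' \<in> sets S" and E': "E' \<in> sets \<pi>"
    using measurable_sets[OF T' A] measurable_sets[OF G E] by (auto simp: A'_def E'_def)
  have AT: "T y \<in> A' \<longleftrightarrow> y \<in> A" if "y \<in> space S" for y
    using inv[OF that] measurable_space[OF T that] by (simp add: A'_def)
  have P'_sets: "sets (P' (G \<theta>)) = sets S" if "\<theta> \<in> space \<pi>" for \<theta>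
    using measurable_space[OF P' measurable_space[OF G that]] by (simp add: space_prob_algebra)
  note P'_space = sets_eq_imp_space_eq[OF P'_sets]
  have \<kappa>E_meas: "(\<lambda>y. emeasure (\<kappa> y) E') \<in> borel_measurable S"
    using measurable_compose[OF measurable_prob_algebraD[OF \<kappa>_meas] measurable_emeasure_subprob_algebra[OF E']] .
  have P_A': "emeasure (P \<theta>) A' = emeasure (P' (G \<theta>)) A" if "\<theta> \<in> space \<pi>" for \<theta>
  proof -
    have "T -` A' \<inter> space (P' (G \<theta>)) = A"
      using AT sets.sets_into_space[OF A] by (auto simp: P'_space[OF that])
    then show ?thesis
      unfolding P[OF that] using T A' P'_sets[OF that]
      by (subst emeasure_distr) (auto cong: measurable_cong_sets)
  qed
  have inner: "(\<integral>\<^sup>+y\<in>A. emeasure (distr (\<kappa> (T y)) N G) E \<partial>P' (G \<theta>)) = (\<integral>\<^sup>+y\<in>A'. emeasure (\<kappa> y) E' \<partial>P \<theta>)"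
    if \<theta>: "\<theta> \<in> space \<pi>" for \<theta>
  proof -
    have "(\<integral>\<^sup>+y\<in>A. emeasure (distr (\<kappa> (T y)) N G) E \<partial>P' (G \<theta>)) =
        (\<integral>\<^sup>+y. emeasure (\<kappa> (T y)) E' * indicator A' (T y) \<partial>P' (G \<theta>))"
    proof (rule nn_integral_cong)
      fix y assume "y \<in> space (P' (G \<theta>))"
      then have y: "y \<in> space S" by (simp add: P'_space[OF \<theta>])
      have Ty: "sets (\<kappa> (T y)) = sets \<pi>"
        by (intro \<kappa>_sets measurable_space[OF T y])
      have "emeasure (distr (\<kappa> (T y)) N G) E = emeasure (\<kappa> (T y)) E'"
        using G E Ty sets_eq_imp_space_eq[OF Ty]
        by (subst emeasure_distr) (auto simp: E'_def cong: measurable_cong_sets)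
      then show "emeasure (distr (\<kappa> (T y)) N G) E * indicator A y = emeasure (\<kappa> (T y)) E' * indicator A' (T y)"
        using AT[OF y] by (simp add: indicator_def)
    qed
    also have "\<dots> = (\<integral>\<^sup>+y\<in>A'. emeasure (\<kappa> y) E' \<partial>P \<theta>)"
      unfolding P[OF \<theta>] using T A' \<kappa>E_meas P'_sets[OF \<theta>]
      by (subst nn_integral_distr) (auto cong: measurable_cong_sets)
    finally show ?thesis .
  qed
  have P'A_meas: "(\<lambda>v. emeasure (P' v) A) \<in> borel_measurable N"
    using measurable_compose[OF measurable_prob_algebraD[OF P'] measurable_emeasure_subprob_algebra[OF A]] .
  have \<kappa>'E_meas: "(\<lambda>y. emeasure (distr (\<kappa> (T y)) N G) E) \<in> borel_measurable S"
    using measurable_compose[OF measurable_prob_algebraD[OF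
      measurable_compose[OF measurable_compose[OF T \<kappa>_meas] measurable_distr_prob_space[OF G]]]
      measurable_emeasure_subprob_algebra[OF E]] by simp
  have "(\<lambda>v. \<integral>\<^sup>+y\<in>A. emeasure (distr (\<kappa> (T y)) N G) E \<partial>P' v) \<in> borel_measurable N"
    using A \<kappa>'E_meas
    by (intro measurable_compose[OF measurable_prob_algebraD[OF P'] nn_integral_measurable_subprob_algebra]) auto
  then have "(\<integral>\<^sup>+v. (\<integral>\<^sup>+y\<in>A. emeasure (distr (\<kappa> (T y)) N G) E \<partial>P' v) \<partial>distr \<pi> N G) =
      (\<integral>\<^sup>+\<theta>. (\<integral>\<^sup>+y\<in>A'. emeasure (\<kappa> y) E' \<partial>P \<theta>) \<partial>\<pi>)"
    using G by (subst nn_integral_distr) (auto intro!: nn_integral_cong simp: inner)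
  also have "\<dots> = (\<integral>\<^sup>+\<theta>\<in>E'. emeasure (P \<theta>) A' \<partial>\<pi>)"
    using \<kappa> A' E' by (simp add: is_posterior_def)
  also have "\<dots> = (\<integral>\<^sup>+v\<in>E. emeasure (P' v) A \<partial>distr \<pi> N G)"
    using G P'A_meas E
    by (subst nn_integral_distr) (auto intro!: nn_integral_cong simp: P_A' E'_def indicator_def)
  finally show "(\<integral>\<^sup>+v\<in>E. emeasure (P' v) A \<partial>distr \<pi> N G) =
      (\<integral>\<^sup>+v. (\<integral>\<^sup>+y\<in>A. emeasure (distr (\<kappa> (T y)) N G) E \<partial>P' v) \<partial>distr \<pi> N G)" ..
qed


section \<open>The space of square integrable functions on a domain\<close>

text \<open>Membership in \<open>L2 \<Omega>\<close> is stated through an arbitrary choice of representatives, which respects the vector space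
  operations only almost everywhere; the next lemmas record this.\<close>

lemma l2_rel_rep_abs: "l2_rel f f \<Longrightarrow> l2_rel (rep_l2 (abs_l2 f)) f"
  by (rule Quotient3_rep_abs[OF Quotient3_l2])

lemma sq_integrable_rep_l2: "sq_integrable (rep_l2 f)"
  using Quotient3_rep_reflp[OF Quotient3_l2, of f] by (simp add: l2_rel_def)

lemma rep_l2_add: "AE x in lborel. rep_l2 (f + g) x = rep_l2 f x + rep_l2 g x"
  using l2_rel_rep_abs[of "\<lambda>x. rep_l2 f x + rep_l2 g x"]
  by (simp add: sq_integrable_rep_l2 plus_l2_def l2_rel_def sq_integrable_add)

lemma rep_l2_scaleR: "AE x in lborel. rep_l2 (c *\<^sub>R f) x = c * rep_l2 f x"
  using l2_rel_rep_abs[of "\<lambda>x. c * rep_l2 f x"]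
  by (simp add: sq_integrable_rep_l2 scaleR_l2_def l2_rel_def sq_integrable_scale)

lemma rep_l2_0: "AE x in lborel. rep_l2 0 (x::'a::euclidean_space) = 0"
  using l2_rel_rep_abs[of "\<lambda>x::'a. 0"] by (simp add: zero_l2_def l2_rel_def sq_integrable_zero)

lemma subspace_L2: "subspace (L2 \<Omega>)"
  unfolding subspace_def L2_def mem_Collect_eq
proof (intro conjI ballI allI)
  show "AE x in lborel. x \<notin> \<Omega> \<longrightarrow> rep_l2 0 x = 0"
    using rep_l2_0 by eventually_elim simp
next
  fix f g :: "'a l2"
  assume "f \<in> {f. AE x in lborel. x \<notin> \<Omega> \<longrightarrow> rep_l2 f x = 0}" "g \<in> {f. AE x in lborel. x \<notin> \<Omega> \<longrightarrow> rep_l2 f x = 0}"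
  then have "AE x in lborel. x \<notin> \<Omega> \<longrightarrow> rep_l2 f x = 0" "AE x in lborel. x \<notin> \<Omega> \<longrightarrow> rep_l2 g x = 0"
    by simp_all
  with rep_l2_add[of f g] show "AE x in lborel. x \<notin> \<Omega> \<longrightarrow> rep_l2 (f + g) x = 0"
    by eventually_elim simp
next
  fix c and f :: "'a l2"
  assume "f \<in> {f. AE x in lborel. x \<notin> \<Omega> \<longrightarrow> rep_l2 f x = 0}"
  then have "AE x in lborel. x \<notin> \<Omega> \<longrightarrow> rep_l2 f x = 0"
    by simp
  with rep_l2_scaleR[of c f] show "AE x in lborel. x \<notin> \<Omega> \<longrightarrow> rep_l2 (c *\<^sub>R f) x = 0"
    by eventually_elim simp
qed

lemma bounded_linear_on_continuous_on:
  assumes "bounded_linear_on S K" "subspace S"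
  shows "continuous_on S K"
proof -
  obtain c where lin: "linear_on S K" and c: "\<And>x. x \<in> S \<Longrightarrow> norm (K x) \<le> c * norm x"
    using assms(1) by (auto simp: bounded_linear_on_def)
  have "dist (K x) (K y) \<le> max c 0 * dist x y" if "x \<in> S" "y \<in> S" for x y
  proof -
    have "dist (K x) (K y) \<le> c * dist x y"
      using c[OF subspace_diff[OF assms(2) that]] linear_on_diff[OF lin assms(2) that] by (simp add: dist_norm)
    also have "\<dots> \<le> max c 0 * dist x y"
      by (intro mult_right_mono) auto
    finally show ?thesis .
  qed
  then have "(max c 0)-lipschitz_on S K"
    by (intro lipschitz_onI) auto
  then show ?thesis
    by (rule lipschitz_on_continuous_on)
qed


section \<open>The posterior distributions of the nonlinear and the linear model\<close>

context semilinear_bvp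
begin

lemma L_solution_in_L2: "f \<in> F \<Longrightarrow> L (u f) \<in> L2 \<Omega>"
  using solution diff_op by (auto simp: linear_differential_operator_def)

lemma data_kernel_L:
  assumes "white_noise M (L2 \<Omega>) \<Xi>"
  shows "(\<lambda>v. data_law M \<Xi> (L2 \<Omega>) n (K v)) \<in> borel_on (L2 \<Omega>) \<rightarrow>\<^sub>M prob_algebra (data_space (L2 \<Omega>))"
proof (rule data_law_kernel[OF assms])
  fix \<phi>
  have "continuous_on (L2 \<Omega>) K"
    by (rule bounded_linear_on_continuous_on[OF K_bounded_linear(2) subspace_L2])
  then have "continuous_on (L2 \<Omega>) (\<lambda>v. inner (K v) \<phi>)"
    by (intro continuous_intros)
  then show "(\<lambda>v. inner (K v) \<phi>) \<in> borel_measurable (borel_on (L2 \<Omega>))"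
    by (rule borel_measurable_continuous_on_restrict)
qed

text \<open>The Cameron-Martin space of the noise indexed by \<open>L2 \<Omega>\<close> contains all differences of signals, because
  signals \<open>K v\<close> lie in the index space itself.\<close>

lemma data_laws_L_absolutely_continuous:
  assumes "white_noise M (L2 \<Omega>) \<Xi>" "0 < n" "v \<in> L2 \<Omega>" "w \<in> L2 \<Omega>"
  shows "absolutely_continuous (data_law M \<Xi> (L2 \<Omega>) n (K v)) (data_law M \<Xi> (L2 \<Omega>) n (K w))"
  using assms K_bounded_linear(1)
  by (intro data_law_absolutely_continuous subspace_scale subspace_diff subspace_L2) auto

text \<open>The argument \<open>y\<close> is an observation in model (L); the corresponding observation in model (N) adds the
  coordinates of \<open>gt\<close>. The exceptional set may depend on \<open>E\<close>.\<close>

proposition posterior_L_eq_posterior_N: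
  fixes M :: "'w measure"
  assumes noise: "white_noise M (L2 \<Omega>) \<Xi>" and n: "0 < n"
    and \<pi>: "prob_space \<pi>" "sets \<pi> = sets (borel_on F)"
    and induced: "(\<lambda>f. L (u f)) \<in> \<pi> \<rightarrow>\<^sub>M borel_on (L2 \<Omega>)"
      "distr \<pi> (borel_on (L2 \<Omega>)) (\<lambda>f. L (u f)) = \<pi>'"
    and posterior_L: "is_posterior (data_space (L2 \<Omega>)) \<pi>' (\<lambda>v. data_law M \<Xi> (L2 \<Omega>) n (K v)) \<kappa>'"
    and posterior_N: "is_posterior (data_space (L2 \<Omega>)) \<pi> (\<lambda>f. data_law M \<Xi> (L2 \<Omega>) n (u f)) \<kappa>"
    and v0: "v0 \<in> L2 \<Omega>" and E: "E \<in> sets (borel_on (L2 \<Omega>))"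
  shows "AE y in data_law M \<Xi> (L2 \<Omega>) n (K v0).
    measure (\<kappa>' y) E = measure (\<kappa> (\<lambda>\<phi>\<in>L2 \<Omega>. y \<phi> + inner gt \<phi>)) {f \<in> F. L (u f) \<in> E}"
proof -
  let ?S = "data_space (L2 \<Omega>)" and ?N = "borel_on (L2 \<Omega>)"
  let ?T = "\<lambda>y. \<lambda>\<phi>\<in>L2 \<Omega>. y \<phi> + inner gt \<phi>" and ?T' = "\<lambda>y. \<lambda>\<phi>\<in>L2 \<Omega>. y \<phi> - inner gt \<phi>"
  have T: "?T \<in> ?S \<rightarrow>\<^sub>M ?S" and T': "?T' \<in> ?S \<rightarrow>\<^sub>M ?S"
    by measurable
  have sp: "space \<pi> = F"
    using sets_eq_imp_space_eq[OF \<pi>(2)] by (simp add: space_restrict_space)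
  have sets': "sets \<pi>' = sets ?N"
    using induced(2) by auto
  have sp': "space \<pi>' = L2 \<Omega>"
    using sets_eq_imp_space_eq[OF sets'] by (simp add: space_restrict_space)
  have \<pi>': "prob_space \<pi>'"
    using prob_space.prob_space_distr[OF \<pi>(1) induced(1)] induced(2) by simp
  have kernel: "(\<lambda>v. data_law M \<Xi> (L2 \<Omega>) n (K v)) \<in> \<pi>' \<rightarrow>\<^sub>M prob_algebra ?S"
    using data_kernel_L[OF noise] by (simp add: measurable_cong_sets[OF sets' refl])
  have "is_posterior ?S (distr \<pi> ?N (\<lambda>f. L (u f))) (\<lambda>v. data_law M \<Xi> (L2 \<Omega>) n (K v))
      (\<lambda>y. distr (\<kappa> (?T y)) ?N (\<lambda>f. L (u f)))"
  proof (rule posterior_pushforward[OF posterior_N induced(1) T T' _ data_kernel_L[OF noise]])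
    show "?T' (?T y) = y" if "y \<in> space ?S" for y
      using that by (auto simp: space_PiM PiE_iff extensional_def fun_eq_iff)
    show "data_law M \<Xi> (L2 \<Omega>) n (u f) = distr (data_law M \<Xi> (L2 \<Omega>) n (K (L (u f)))) ?S ?T"
      if "f \<in> space \<pi>" for f
      using data_law_add[OF noise, of n "K (L (u f))" gt] solution_eq[of f] that sp by simp
  qed
  then have pushed: "is_posterior ?S \<pi>' (\<lambda>v. data_law M \<Xi> (L2 \<Omega>) n (K v))
      (\<lambda>y. distr (\<kappa> (?T y)) ?N (\<lambda>f. L (u f)))"
    using induced(2) by simp
  have "AE y in data_law M \<Xi> (L2 \<Omega>) n (K v0). measure (\<kappa>' y) E = measure (distr (\<kappa> (?T y)) ?N (\<lambda>f. L (u f))) E"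
    using data_laws_L_absolutely_continuous[OF noise n _ v0] sp' E sets'
    by (intro posterior_AE_unique_dominated[OF \<pi>' kernel posterior_L pushed]) (auto simp: data_law_def)
  moreover have "AE y in data_law M \<Xi> (L2 \<Omega>) n (K v0). y \<in> space ?S"
    by (rule AE_I2) (simp add: data_law_def)
  ultimately show ?thesis
  proof eventually_elim
    case (elim y)
    have "\<kappa> \<in> ?S \<rightarrow>\<^sub>M prob_algebra \<pi>"
      using posterior_N by (simp add: is_posterior_def)
    from measurable_space[OF this measurable_space[OF T elim(2)]]
    have sets: "sets (\<kappa> (?T y)) = sets \<pi>"
      by (simp add: space_prob_algebra)
    have "measure (distr (\<kappa> (?T y)) ?N (\<lambda>f. L (u f))) E = measure (\<kappa> (?T y)) {f \<in> F. L (u f) \<in> E}"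
      using induced(1) E sets sets_eq_imp_space_eq[OF sets] sp
      by (subst measure_distr) (auto simp: vimage_def Int_def conj_commute cong: measurable_cong_sets)
    with elim(1) show ?case by simp
  qed
qed

end


section \<open>Transfer of the contraction rate\<close>

lemma Collect_in_sets_borel_on:
  assumes "{x. Q x} \<in> sets borel"
  shows "{x \<in> A. Q x} \<in> sets (borel_on A)"
proof -
  have "{x \<in> A. Q x} = A \<inter> {x. Q x}"
    by blast
  then show ?thesis
    using assms by (simp only: sets_restrict_space imageI)
qed

text \<open>The chord from \<open>0\<close> to \<open>t * x\<close> lies below the graph at \<open>x\<close>, and its left end is nonnegative.\<close>

lemma concave_on_scale_le:
  fixes w :: "real \<Rightarrow> real"
  assumes "concave_on {0..} w" "0 \<le> w 0" "1 \<le> t" "0 \<le> x"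
  shows "w (t * x) \<le> t * w x"
proof -
  have "(1 - 1 / t) * w 0 + 1 / t * w (t * x) \<le> w ((1 - 1 / t) *\<^sub>R 0 + (1 / t) *\<^sub>R (t * x))"
    using assms by (intro concave_onD[OF assms(1)]) auto
  also have "(1 - 1 / t) *\<^sub>R 0 + (1 / t) *\<^sub>R (t * x) = x"
    using assms(3) by simp
  finally have "(1 - 1 / t) * w 0 + 1 / t * w (t * x) \<le> w x" .
  moreover have "0 \<le> (1 - 1 / t) * w 0"
    using assms(2,3) by (intro mult_nonneg_nonneg) auto
  ultimately have "1 / t * w (t * x) \<le> w x"
    by linarith
  then show ?thesis
    using assms(3) by (simp add: field_simps)
qed

text \<open>If \<open>Z\<close> exceeds \<open>\<delta>\<close>, one of the two deviations that dominate it exceeds \<open>\<delta> / 2\<close>.\<close>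

lemma tends_in_prob_0_le_sum:
  assumes X: "tends_in_prob R X c" and Y: "tends_in_prob R Y d"
    and R: "\<And>n. finite_measure (R n)"
    and meas: "\<And>n \<delta>. 1 \<le> n \<Longrightarrow> {y \<in> space (R n). \<bar>X n y - c\<bar> > \<delta>} \<in> sets (R n)"
      "\<And>n \<delta>. 1 \<le> n \<Longrightarrow> {y \<in> space (R n). \<bar>Y n y - d\<bar> > \<delta>} \<in> sets (R n)"
    and le: "\<forall>\<^sub>F n in sequentially. AE y in R n. \<bar>Z n y\<bar> \<le> \<bar>X n y - c\<bar> + \<bar>Y n y - d\<bar>"
  shows "tends_in_prob R Z 0"
  unfolding tends_in_prob_def
proof (intro allI impI)
  fix \<delta> :: real assume \<delta>: "\<delta> > 0"
  let ?X = "\<lambda>n. {y \<in> space (R n). \<bar>X n y - c\<bar> > \<delta> / 2}" and ?Y = "\<lambda>n. {y \<in> space (R n). \<bar>Y n y - d\<bar> > \<delta> / 2}"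
  have "(\<lambda>n. measure (R n) (?X n)) \<longlonglongrightarrow> 0" "(\<lambda>n. measure (R n) (?Y n)) \<longlonglongrightarrow> 0"
    using X[unfolded tends_in_prob_def, rule_format, of "\<delta> / 2"]
      Y[unfolded tends_in_prob_def, rule_format, of "\<delta> / 2"] \<delta> by auto
  from tendsto_add[OF this] have lim: "(\<lambda>n. measure (R n) (?X n) + measure (R n) (?Y n)) \<longlonglongrightarrow> 0"
    by simp
  show "(\<lambda>n. measure (R n) {y \<in> space (R n). \<bar>Z n y - 0\<bar> > \<delta>}) \<longlonglongrightarrow> 0"
  proof (rule tendsto_sandwich[OF _ _ tendsto_const lim])
    show "\<forall>\<^sub>F n in sequentially. 0 \<le> measure (R n) {y \<in> space (R n). \<bar>Z n y - 0\<bar> > \<delta>}"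
      by simp
    show "\<forall>\<^sub>F n in sequentially. measure (R n) {y \<in> space (R n). \<bar>Z n y - 0\<bar> > \<delta>} \<le>
        measure (R n) (?X n) + measure (R n) (?Y n)"
      using le eventually_ge_at_top[of "1::nat"]
    proof eventually_elim
      case (elim n)
      interpret finite_measure "R n" by (rule R)
      have "measure (R n) {y \<in> space (R n). \<bar>Z n y - 0\<bar> > \<delta>} \<le> measure (R n) (?X n \<union> ?Y n)"
      proof (rule finite_measure_mono_AE)
        show "AE y in R n. y \<in> {y \<in> space (R n). \<bar>Z n y - 0\<bar> > \<delta>} \<longrightarrow> y \<in> ?X n \<union> ?Y n"
          using elim(1) by eventually_elim auto
        show "?X n \<union> ?Y n \<in> sets (R n)"
          by (intro sets.Un meas elim)
      qed
      also have "\<dots> \<le> measure (R n) (?X n) + measure (R n) (?Y n)"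
        by (intro measure_Un_le meas elim)
      finally show ?case .
    qed
  qed
qed

lemma tends_in_prob_distr:
  assumes "\<And>n. 1 \<le> n \<Longrightarrow> P n = distr (R n) S T" "\<And>n. T \<in> R n \<rightarrow>\<^sub>M S"
    and "\<And>n. 1 \<le> n \<Longrightarrow> Z n \<in> borel_measurable S"
    and "tends_in_prob R (\<lambda>n y. Z n (T y)) c"
  shows "tends_in_prob P Z c"
  unfolding tends_in_prob_def
proof (intro allI impI)
  fix \<delta> :: real assume "\<delta> > 0"
  with assms(4) have lim: "(\<lambda>n. measure (R n) {y \<in> space (R n). \<bar>Z n (T y) - c\<bar> > \<delta>}) \<longlonglongrightarrow> 0"
    by (simp add: tends_in_prob_def)
  have "\<forall>\<^sub>F n in sequentially. measure (R n) {y \<in> space (R n). \<bar>Z n (T y) - c\<bar> > \<delta>} =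
      measure (P n) {y \<in> space (P n). \<bar>Z n y - c\<bar> > \<delta>}"
    using eventually_ge_at_top[of "1::nat"]
  proof eventually_elim
    case (elim n)
    have [measurable]: "Z n \<in> borel_measurable S" "T \<in> R n \<rightarrow>\<^sub>M S"
      using assms elim by auto
    have "measure (distr (R n) S T) {y \<in> space S. \<bar>Z n y - c\<bar> > \<delta>} =
        measure (R n) (T -` {y \<in> space S. \<bar>Z n y - c\<bar> > \<delta>} \<inter> space (R n))"
      by (rule measure_distr) measurable
    also have "T -` {y \<in> space S. \<bar>Z n y - c\<bar> > \<delta>} \<inter> space (R n) = {y \<in> space (R n). \<bar>Z n (T y) - c\<bar> > \<delta>}"
      using measurable_space[OF assms(2)] by auto
    finally show ?case
      by (simp add: assms(1)[OF elim])
  qed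
  with lim show "(\<lambda>n. measure (P n) {y \<in> space (P n). \<bar>Z n y - c\<bar> > \<delta>}) \<longlonglongrightarrow> 0"
    by (rule Lim_transform_eventually)
qed

theorem proposition3p1:
  fixes \<Omega> :: "'a::euclidean_space set"
    and B :: "'a l2 \<Rightarrow> 'b::real_vector"
    and L K u e :: "'a l2 \<Rightarrow> 'a l2"
    and M :: "'w measure"
    and \<Xi> :: "'a l2 \<Rightarrow> 'w \<Rightarrow> real"
    and \<pi>t \<pi> :: "nat \<Rightarrow> 'a l2 measure"
    and \<kappa>t \<kappa> :: "nat \<Rightarrow> ('a l2 \<Rightarrow> real) \<Rightarrow> 'a l2 measure"
    and Vn :: "nat \<Rightarrow> 'a l2 set"
    and \<omega> :: "nat \<Rightarrow> real \<Rightarrow> real"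
    and \<epsilon> :: "nat \<Rightarrow> real"
  assumes setting: "semilinear_bvp \<Omega> D L B K C h g gt F u e"
    and noise: "white_noise M (L2 \<Omega>) \<Xi>"
    and truth: "f0 \<in> F" "v0 = L (u f0)"
    and prior_L: "\<And>n. n \<ge> 1 \<Longrightarrow> prob_space (\<pi>t n) \<and> sets (\<pi>t n) = sets (borel_on (L2 \<Omega>))"
    and prior_N: "\<And>n. n \<ge> 1 \<Longrightarrow> prob_space (\<pi> n) \<and> sets (\<pi> n) = sets (borel_on F)"
    and induced: "\<And>n. n \<ge> 1 \<Longrightarrow> (\<lambda>f. L (u f)) \<in> \<pi> n \<rightarrow>\<^sub>M borel_on (L2 \<Omega>) \<and>
          distr (\<pi> n) (borel_on (L2 \<Omega>)) (\<lambda>f. L (u f)) = \<pi>t n"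
    and posterior_L: "\<And>n. n \<ge> 1 \<Longrightarrow>
          is_posterior (data_space (L2 \<Omega>)) (\<pi>t n) (\<lambda>v. data_law M \<Xi> (L2 \<Omega>) n (K v)) (\<kappa>t n)"
    and posterior_N: "\<And>n. n \<ge> 1 \<Longrightarrow>
          is_posterior (data_space (L2 \<Omega>)) (\<pi> n) (\<lambda>f. data_law M \<Xi> (L2 \<Omega>) n (u f)) (\<kappa> n)"
    and contraction_L: "contraction_rate (\<lambda>n. data_law M \<Xi> (L2 \<Omega>) n (K v0)) \<kappa>t
          (L2 \<Omega>) (\<lambda>v w. norm (v - w)) v0 \<epsilon>"
    and sieve: "\<And>n. n \<ge> 1 \<Longrightarrow> Vn n \<in> sets (borel_on (L2 \<Omega>))"
    and modulus: "\<And>n. n \<ge> 1 \<Longrightarrow> \<omega> n \<in> {0..} \<rightarrow> {0..} \<and> mono_on {0..} (\<omega> n) \<and>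
          (\<omega> n \<longlongrightarrow> 0) (at_right 0)"
    and stability: "\<And>n v. n \<ge> 1 \<Longrightarrow> v \<in> Vn n \<Longrightarrow> norm (e v - e v0) \<le> \<omega> n (norm (v - v0))"
    and sieve_mass: "tends_in_prob (\<lambda>n. data_law M \<Xi> (L2 \<Omega>) n (K v0))
          (\<lambda>n y. measure (\<kappa>t n y) (Vn n)) 1"
  shows "(\<forall>m. filterlim m at_top sequentially \<longrightarrow>
           tends_in_prob (\<lambda>n. data_law M \<Xi> (L2 \<Omega>) n (u f0))
             (\<lambda>n y. measure (\<kappa> n y) {f\<in>F. norm (f - f0) > \<omega> n (m n * \<epsilon> n)}) 0)
       \<and> ((\<forall>n\<ge>1. concave_on {0..} (\<omega> n)) \<and> (\<forall>n\<ge>1. \<omega> n (\<epsilon> n) > 0) \<longrightarrow>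
           contraction_rate (\<lambda>n. data_law M \<Xi> (L2 \<Omega>) n (u f0)) \<kappa>
             F (\<lambda>f f'. norm (f - f')) f0 (\<lambda>n. \<omega> n (\<epsilon> n)))"
proof -
  interpret semilinear_bvp \<Omega> D L B K C h g gt F u e
    by (rule setting)
  let ?S = "data_space (L2 \<Omega>)"
  let ?P = "\<lambda>n. data_law M \<Xi> (L2 \<Omega>) n (u f0)" and ?R = "\<lambda>n. data_law M \<Xi> (L2 \<Omega>) n (K v0)"
  let ?T = "\<lambda>y. \<lambda>\<phi>\<in>L2 \<Omega>. y \<phi> + inner gt \<phi>"
  have v0: "v0 \<in> L2 \<Omega>" and f0: "f0 = e v0"
    using L_solution_in_L2 solution_map(2) truth by auto
  have \<epsilon>: "0 < \<epsilon> n" if "1 \<le> n" for n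
    using contraction_L that by (simp add: contraction_rate_def)
  have P_eq: "?P n = distr (?R n) ?S ?T" for n
    using data_law_add[OF noise, of n "K v0" gt] solution_eq[OF truth(1)] truth(2) by simp
  have R_sets: "sets (?R n) = sets ?S" for n
    by (simp add: data_law_def)
  note R_space = sets_eq_imp_space_eq[OF R_sets]
  have R_prob: "prob_space (?R n)" for n
    using measurable_space[OF data_kernel_L[OF noise], of v0 n] v0
    by (simp add: space_prob_algebra space_restrict_space)
  have T: "?T \<in> ?R n \<rightarrow>\<^sub>M ?S" for n
    unfolding measurable_cong_sets[OF R_sets refl] by measurable
  have post_L: "\<kappa>t n \<in> ?S \<rightarrow>\<^sub>M prob_algebra (borel_on (L2 \<Omega>))" if "1 \<le> n" for n
    using posterior_L[OF that] prob_algebra_cong[of "\<pi>t n" "borel_on (L2 \<Omega>)"] prior_L[OF that]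
    by (simp add: is_posterior_def)
  have post_N: "\<kappa> n \<in> ?S \<rightarrow>\<^sub>M prob_algebra (borel_on F)" if "1 \<le> n" for n
    using posterior_N[OF that] prob_algebra_cong[of "\<pi> n" "borel_on F"] prior_N[OF that]
    by (simp add: is_posterior_def)
  have post_L_meas: "(\<lambda>y. measure (\<kappa>t n y) E) \<in> borel_measurable ?S"
    if "1 \<le> n" "E \<in> sets (borel_on (L2 \<Omega>))" for n E
    using measurable_compose[OF post_L[OF that(1)] measurable_measure_prob_algebra[OF that(2)]] .
  have post_N_meas: "(\<lambda>y. measure (\<kappa> n y) E) \<in> borel_measurable ?S"
    if "1 \<le> n" "E \<in> sets (borel_on F)" for n E
    using measurable_compose[OF post_N[OF that(1)] measurable_measure_prob_algebra[OF that(2)]] .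
  have far_L: "{v \<in> L2 \<Omega>. t \<le> norm (v - v0)} \<in> sets (borel_on (L2 \<Omega>))" for t
    by (intro Collect_in_sets_borel_on borel_closed closed_Collect_le continuous_intros)
  have far_N: "{f \<in> F. t < norm (f - f0)} \<in> sets (borel_on F)" for t
    by (intro Collect_in_sets_borel_on borel_open open_Collect_less continuous_intros)
  have closed_far_N: "{f \<in> F. t \<le> norm (f - f0)} \<in> sets (borel_on F)" for t
    by (intro Collect_in_sets_borel_on borel_closed closed_Collect_le continuous_intros)
  \<comment> \<open>The estimate at a fixed stage. The set A is free, so that both > and \<ge> deviations are covered.\<close>
  have stage: "AE y in ?R n. \<bar>measure (\<kappa> n (?T y)) A\<bar> \<le>
      \<bar>measure (\<kappa>t n y) (Vn n) - 1\<bar> + \<bar>measure (\<kappa>t n y) {v \<in> L2 \<Omega>. r \<le> norm (v - v0)} - 0\<bar>"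
    if n: "1 \<le> n" and r: "0 < r" and A: "A \<subseteq> {f \<in> F. norm (f - f0) > \<omega> n r}" for n r A
  proof -
    let ?out = "L2 \<Omega> - Vn n" and ?far = "{v \<in> L2 \<Omega>. r \<le> norm (v - v0)}"
    have out: "?out \<in> sets (borel_on (L2 \<Omega>))"
      using sets.compl_sets[OF sieve[OF n]] by (simp add: space_restrict_space)
    have transfer: "AE y in ?R n. measure (\<kappa>t n y) E = measure (\<kappa> n (?T y)) {f \<in> F. L (u f) \<in> E}"
      if "E \<in> sets (borel_on (L2 \<Omega>))" for E
      using n induced[OF n] prior_N[OF n] that
      by (intro posterior_L_eq_posterior_N[OF noise _ _ _ _ _ posterior_L[OF n] posterior_N[OF n] v0]) auto
    have "AE y in ?R n. y \<in> space ?S"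
      by (rule AE_I2) (simp add: R_space)
    with transfer[OF out] transfer[OF far_L[of r]] show ?thesis
    proof eventually_elim
      case (elim y)
      have Ty: "?T y \<in> space ?S"
        using measurable_space[OF T[of n]] elim(3) R_space by blast
      have N: "prob_space (\<kappa> n (?T y))" "sets (\<kappa> n (?T y)) = sets (borel_on F)"
        using measurable_space[OF post_N[OF n] Ty] by (auto simp: space_prob_algebra)
      have Lp: "prob_space (\<kappa>t n y)" "sets (\<kappa>t n y) = sets (borel_on (L2 \<Omega>))"
        using measurable_space[OF post_L[OF n] elim(3)] by (auto simp: space_prob_algebra)
      interpret N: prob_space "\<kappa> n (?T y)" by (rule N)
      interpret Lp: prob_space "\<kappa>t n y" by (rule Lp)
      have pull: "{f \<in> F. L (u f) \<in> E} \<in> sets (\<kappa> n (?T y))" if "E \<in> sets (borel_on (L2 \<Omega>))" for E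
      proof -
        have G: "(\<lambda>f. L (u f)) \<in> borel_on F \<rightarrow>\<^sub>M borel_on (L2 \<Omega>)"
          using induced[OF n] prior_N[OF n] by (simp cong: measurable_cong_sets)
        have "(\<lambda>f. L (u f)) -` E \<inter> space (borel_on F) = {f \<in> F. L (u f) \<in> E}"
          by (auto simp: space_restrict_space)
        then show ?thesis
          using measurable_sets[OF G that] N(2) by simp
      qed
      \<comment> \<open>A parameter far from f0 has a bad v = L (u f), by stability and monotonicity of the modulus.\<close>
      have "A \<subseteq> {f \<in> F. L (u f) \<in> ?out} \<union> {f \<in> F. L (u f) \<in> ?far}"
      proof (rule subsetI, rule ccontr)
        fix f assume "f \<in> A"
          and not: "f \<notin> {f \<in> F. L (u f) \<in> ?out} \<union> {f \<in> F. L (u f) \<in> ?far}"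
        then have f: "f \<in> F" "norm (f - f0) > \<omega> n r"
          using A by auto
        have v: "L (u f) \<in> Vn n" "norm (L (u f) - v0) \<le> r"
          using f not L_solution_in_L2[of f] by auto
        have "norm (f - f0) = norm (e (L (u f)) - e v0)"
          using f solution_map(2)[of f] f0 by simp
        also have "\<dots> \<le> \<omega> n (norm (L (u f) - v0))"
          by (rule stability[OF n v(1)])
        also have "\<dots> \<le> \<omega> n r"
          using modulus[OF n] v(2) r by (auto intro: mono_onD)
        finally show False
          using f by simp
      qed
      then have "measure (\<kappa> n (?T y)) A \<le>
          measure (\<kappa> n (?T y)) ({f \<in> F. L (u f) \<in> ?out} \<union> {f \<in> F. L (u f) \<in> ?far})"
        by (intro N.finite_measure_mono sets.Un pull out far_L)
      also have "\<dots> \<le> measure (\<kappa> n (?T y)) {f \<in> F. L (u f) \<in> ?out} + measure (\<kappa> n (?T y)) {f \<in> F. L (u f) \<in> ?far}"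
        by (intro measure_Un_le pull out far_L)
      also have "\<dots> = measure (\<kappa>t n y) ?out + measure (\<kappa>t n y) ?far"
        by (simp only: elim)
      also have "measure (\<kappa>t n y) ?out = 1 - measure (\<kappa>t n y) (Vn n)"
        using Lp.prob_compl[of "Vn n"] sieve[OF n] Lp(2) sets_eq_imp_space_eq[OF Lp(2)]
        by (simp add: space_restrict_space)
      finally show ?case
        using measure_nonneg[of "\<kappa> n (?T y)" A] by linarith
    qed
  qed
  have slow: "tends_in_prob ?P (\<lambda>n y. measure (\<kappa> n y) (A n)) 0"
    if m: "filterlim m at_top sequentially" and A_meas: "\<And>n. A n \<in> sets (borel_on F)"
      and A: "\<forall>\<^sub>F n in sequentially. A n \<subseteq> {f \<in> F. norm (f - f0) > \<omega> n (m n * \<epsilon> n)}" for m A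
  proof (rule tends_in_prob_distr[OF P_eq T])
    show "(\<lambda>y. measure (\<kappa> n y) (A n)) \<in> borel_measurable ?S" if "1 \<le> n" for n
      by (intro post_N_meas that A_meas)
    show "tends_in_prob ?R (\<lambda>n y. measure (\<kappa> n (?T y)) (A n)) 0"
    proof (rule tends_in_prob_0_le_sum)
      show "tends_in_prob ?R (\<lambda>n y. measure (\<kappa>t n y) (Vn n)) 1"
        by (rule sieve_mass)
      show "tends_in_prob ?R (\<lambda>n y. measure (\<kappa>t n y) {v \<in> L2 \<Omega>. m n * \<epsilon> n \<le> norm (v - v0)}) 0"
        using contraction_L m by (simp add: contraction_rate_def)
      show "finite_measure (?R n)" for n
        using R_prob by (rule prob_space.finite_measure)
      have exceed: "{y \<in> space (?R n). \<bar>measure (\<kappa>t n y) E - c\<bar> > \<delta>} \<in> sets (?R n)"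
        if "1 \<le> n" "E \<in> sets (borel_on (L2 \<Omega>))" for n E c \<delta>
      proof -
        note [measurable] = post_L_meas[OF that]
        show ?thesis unfolding R_space R_sets by measurable
      qed
      show "{y \<in> space (?R n). \<bar>measure (\<kappa>t n y) (Vn n) - 1\<bar> > \<delta>} \<in> sets (?R n)" if "1 \<le> n" for n \<delta>
        by (intro exceed that sieve)
      show "{y \<in> space (?R n). \<bar>measure (\<kappa>t n y) {v \<in> L2 \<Omega>. m n * \<epsilon> n \<le> norm (v - v0)} - 0\<bar> > \<delta>} \<in> sets (?R n)"
        if "1 \<le> n" for n \<delta>
        by (intro exceed that far_L)
      show "\<forall>\<^sub>F n in sequentially. AE y in ?R n.
          \<bar>measure (\<kappa> n (?T y)) (A n)\<bar> \<le>
          \<bar>measure (\<kappa>t n y) (Vn n) - 1\<bar> + \<bar>measure (\<kappa>t n y) {v \<in> L2 \<Omega>. m n * \<epsilon> n \<le> norm (v - v0)} - 0\<bar>"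
        using eventually_ge_at_top[of "1::nat"] filterlim_at_top_dense[THEN iffD1, OF m, rule_format, of 0] A
        by eventually_elim (intro stage; simp add: \<epsilon>)
    qed
  qed
  moreover have "contraction_rate ?P \<kappa> F (\<lambda>f f'. norm (f - f')) f0 (\<lambda>n. \<omega> n (\<epsilon> n))"
    if concave: "\<forall>n\<ge>1. concave_on {0..} (\<omega> n)" and pos: "\<forall>n\<ge>1. \<omega> n (\<epsilon> n) > 0"
    unfolding contraction_rate_def
  proof (intro conjI allI impI)
    show "\<omega> n (\<epsilon> n) > 0" if "1 \<le> n" for n
      using pos that by simp
    fix m :: "nat \<Rightarrow> real"
    assume m: "filterlim m at_top sequentially"
    \<comment> \<open>The factor 1/2 leaves a strict gap, as \<omega> n (\<epsilon> n) > 0.\<close>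
    have half: "filterlim (\<lambda>n. m n / 2) at_top sequentially"
      using filterlim_tendsto_pos_mult_at_top[OF tendsto_const, of "1/2" m] m by simp
    show "tends_in_prob ?P (\<lambda>n y. measure (\<kappa> n y) {f \<in> F. norm (f - f0) \<ge> m n * \<omega> n (\<epsilon> n)}) 0"
    proof (rule slow[OF half closed_far_N])
      show "\<forall>\<^sub>F n in sequentially. {f \<in> F. norm (f - f0) \<ge> m n * \<omega> n (\<epsilon> n)} \<subseteq>
          {f \<in> F. norm (f - f0) > \<omega> n (m n / 2 * \<epsilon> n)}"
        using eventually_ge_at_top[of "1::nat"] filterlim_at_top[THEN iffD1, OF m, rule_format, of 2]
      proof eventually_elim
        case (elim n)
        have "\<omega> n (m n / 2 * \<epsilon> n) \<le> m n / 2 * \<omega> n (\<epsilon> n)"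
          using concave modulus[OF elim(1)] \<epsilon>[OF elim(1)] elim
          by (intro concave_on_scale_le) (auto simp: Pi_iff)
        also have "\<dots> < m n * \<omega> n (\<epsilon> n)"
          using pos elim by simp
        finally show ?case
          by auto
      qed
    qed
  qed
  ultimately show ?thesis
    using far_N by auto
qed

end
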